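(* Let $F$ be a $P_7$ or a fork$^+$, and let $G$ be a $(C_4, F, \text{hammer})$-free graph. Then $\chi(G)\leq\omega(G)+1$.
   Context: All graphs are finite and simple. $C_k$ is the cycle on $k$ vertices and $P_k$ the path on $k$ vertices. A graph is $(H_1,H_2,\dots)$-free if it has no induced subgraph isomorphic to any $H_i$. A hammer is obtained by identifying an end of $P_3$ with a vertex of a triangle. A fork$^+$ is obtained from $K_{1,3}$ by subdividing one edge twice. $\chi(G)$ and $\omega(G)$ are the chromatic number and clique number. *)

theory Defs
  imports "Graph_Theory.Graph_Theory"
begin

text \<open>Finite simple graphs are represented, as in the library, by the locale \<^locale>\<open>graph\<close>:
  finite symmetric digraphs without loops and parallel arcs. Each undirected edge
  is thus a pair of opposite arcs.\<close>

definition undirected :: "'a set \<Rightarrow> ('a \<times> 'a) set \<Rightarrow> 'a pair_pre_digraph" where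
  "undirected V E = \<lparr> pverts = V, parcs = E \<union> E\<inverse> \<rparr>"

definition path_graph :: "nat \<Rightarrow> nat pair_pre_digraph" where
  "path_graph k = undirected {..<k} {(i, Suc i) | i. Suc i < k}"

text \<open>Meaningful for \<open>k \<ge> 3\<close> only: \<open>k = 1\<close> would give a loop, and \<open>k = 2\<close> a single edge.\<close>

definition cycle_graph :: "nat \<Rightarrow> nat pair_pre_digraph" where
  "cycle_graph k = undirected {..<k} {(i, Suc i mod k) | i. i < k}"

text \<open>The triangle is \<open>0, 1, 2\<close>; the path \<open>2, 3, 4\<close> on three vertices is attached by its end \<open>2\<close>.\<close>

definition hammer :: "nat pair_pre_digraph" where
  "hammer = undirected {0, 1, 2, 3, 4} {(0, 1), (1, 2), (0, 2), (2, 3), (3, 4)}"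

text \<open>The centre of the claw is \<open>0\<close>, with leaves \<open>1\<close>, \<open>2\<close> and \<open>5\<close>; the edge between \<open>0\<close> and \<open>5\<close>
  is subdivided by the two new vertices \<open>3\<close> and \<open>4\<close>.\<close>

definition fork_plus :: "nat pair_pre_digraph" where
  "fork_plus = undirected {0, 1, 2, 3, 4, 5} {(0, 1), (0, 2), (0, 3), (3, 4), (4, 5)}"

definition induced_free :: "('a, 'b) pre_digraph \<Rightarrow> 'c pair_pre_digraph set \<Rightarrow> bool" where
  "induced_free G \<H> \<longleftrightarrow>
    (\<forall>H \<in> \<H>. \<not> (\<exists>K. induced_subgraph K G \<and> digraph_iso (with_proj H) K))"

definition proper_colouring :: "('a, 'b) pre_digraph \<Rightarrow> nat \<Rightarrow> ('a \<Rightarrow> nat) \<Rightarrow> bool" where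
  "proper_colouring G k c \<longleftrightarrow>
    c ` verts G \<subseteq> {..<k} \<and> (\<forall>u v. u \<rightarrow>\<^bsub>G\<^esub> v \<longrightarrow> c u \<noteq> c v)"

definition chromatic_number :: "('a, 'b) pre_digraph \<Rightarrow> nat" where
  "chromatic_number G = (LEAST k. \<exists>c. proper_colouring G k c)"

definition clique :: "('a, 'b) pre_digraph \<Rightarrow> 'a set \<Rightarrow> bool" where
  "clique G S \<longleftrightarrow> S \<subseteq> verts G \<and> (\<forall>u \<in> S. \<forall>v \<in> S. u \<noteq> v \<longrightarrow> u \<rightarrow>\<^bsub>G\<^esub> v)"

text \<open>The empty set is a clique, so the graph without vertices has clique number \<open>0\<close>.\<close>

definition clique_number :: "('a, 'b) pre_digraph \<Rightarrow> nat" where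
  "clique_number G = Max (card ` {S. clique G S})"

lemma pair_graph_undirected:
  assumes "finite V" "E \<subseteq> V \<times> V" "\<And>v. (v, v) \<notin> E"
  shows "pair_graph (undirected V E)"
proof -
  have "finite E" using assms(1,2) by (meson finite_SigmaI finite_subset)
  then show ?thesis
    using assms by unfold_locales (auto simp: undirected_def symmetric_def sym_def)
qed

lemma pair_graph_path_graph: "pair_graph (path_graph k)"
  unfolding path_graph_def by (rule pair_graph_undirected) auto

lemma pair_graph_cycle_graph:
  assumes "k \<ge> 3" shows "pair_graph (cycle_graph k)"
proof -
  have "Suc i mod k \<noteq> i" if "i < k" for i
    using assms that by (cases "Suc i = k") auto
  moreover have "Suc i mod k < k" for i
    using assms by simp
  ultimately show ?thesis
    unfolding cycle_graph_def by (intro pair_graph_undirected) fastforce+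
qed

lemma pair_graph_hammer: "pair_graph hammer"
  unfolding hammer_def by (rule pair_graph_undirected) auto

lemma pair_graph_fork_plus: "pair_graph fork_plus"
  unfolding fork_plus_def by (rule pair_graph_undirected) auto

lemma (in graph) proper_colouring_chromatic_number:
  "\<exists>c. proper_colouring G (chromatic_number G) c"
proof -
  obtain f :: "'a \<Rightarrow> nat" and n where f: "f ` verts G = {i. i < n}" "inj_on f (verts G)"
    using finite_imp_inj_to_nat_seg[OF finite_verts] by blast
  have "proper_colouring G n f"
    unfolding proper_colouring_def
  proof (intro conjI allI impI notI)
    show "f ` verts G \<subseteq> {..<n}" using f(1) by blast
    fix u v assume uv: "u \<rightarrow> v" and eq: "f u = f v"
    have "u = v" using inj_onD[OF f(2) eq] adj_in_verts[OF uv] by blast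
    then show False using uv adj_not_same by blast
  qed
  then have "\<exists>k c. proper_colouring G k c" by blast
  then show ?thesis unfolding chromatic_number_def by (rule LeastI_ex)
qed

lemma (in graph) finite_cliques: "finite {S. clique G S}"
  by (rule finite_subset[of _ "Pow (verts G)"]) (auto simp: clique_def)

lemma (in graph) clique_number_attained: "\<exists>S. clique G S \<and> card S = clique_number G"
proof -
  have "{} \<in> {S. clique G S}" by (simp add: clique_def)
  then have "clique_number G \<in> card ` {S. clique G S}"
    unfolding clique_number_def using finite_cliques by (intro Max_in) auto
  then show ?thesis by auto
qed

end

theory Submission
  imports Defs
begin

text \<open>The proof is by induction on the number of vertices, for graphs all of whose cliques have at most
  \<open>k\<close> vertices and with \<open>k + 1\<close> colours available. A clique cutset lets two colourings be glued,
  a vertex of degree at most \<open>k\<close> can be coloured last, and deleting a universal vertex lowers both the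
  clique size and the number of colours by one. So one may assume that none of these occurs.

  Under this assumption there is no triangle: a graph without \<open>C\<^sub>4\<close>, hammer and clique cutset that
  contains a triangle has a universal vertex (\<open>triangle_imp_universal\<close>). For let \<open>c\<close> be a
  non-universal vertex of a triangle. The neighbours of \<open>c\<close> that attach to a component of the
  non-neighbours do not form a clique, hence \<open>c\<close> lies on a hole of length at least five. Freeness from
  the hammer makes the ends of this hole in the neighbourhood of \<open>c\<close> share a neighbour \<open>a\<close> with \<open>c\<close>,
  and propagates adjacency to \<open>a\<close> along the hole. If \<open>a\<close> had a non-neighbour, two
  nonadjacent neighbours of \<open>a\<close> attaching to the non-neighbours of \<open>a\<close> would likewise be complete to
  the hole, which gives a \<open>C\<^sub>4\<close>. Thus \<open>a\<close> is universal.

  What remains is a connected graph without triangles and without \<open>C\<^sub>4\<close>, of minimum degree at least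
  three, and three colours suffice for it (\<open>triangle_free_colourable\<close>). If it is not bipartite, take a
  shortest odd cycle. If this cycle has length at least seven, a third neighbour of one of its vertices
  sees no other vertex of the cycle, and together they contain both a \<open>P\<^sub>7\<close> and a fork\<open>\<^sup>+\<close>. If it is
  a pentagon, the exclusion of either graph forces every vertex to lie on the pentagon or next to it
  (\<open>pentagon_dominating\<close>), and then a 3-colouring can be written down. Both excluded graphs are
  found at the same places, so that the two cases of the theorem need no separate treatment.\<close>

section \<open>Induced copies of the forbidden graphs\<close>

lemma pverts_fork_plus: "pverts fork_plus = {..<6}"
  by (simp add: fork_plus_def undirected_def lessThan_nat_numeral lessThan_Suc insert_commute)

lemma pverts_hammer: "pverts hammer = {..<5}"
  by (simp add: hammer_def undirected_def lessThan_nat_numeral lessThan_Suc insert_commute)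

lemma parcs_cycle_graph_4:
  "parcs (cycle_graph 4) = {(0,1),(1,2),(2,3),(3,0),(1,0),(2,1),(3,2),(0,3)}"
proof -
  have four: "{..<4::nat} = {0, 1, 2, 3}"
    by (simp add: lessThan_nat_numeral lessThan_Suc insert_commute)
  have mods: "Suc 0 mod 4 = 1" "Suc 1 mod 4 = 2" "Suc 2 mod 4 = 3" "Suc 3 mod 4 = 0"
    by simp_all
  have "{(i, Suc i mod 4) | i. i < 4} = (\<lambda>i. (i, Suc i mod 4)) ` {..<4}" by blast
  also have "\<dots> = {(0,1),(1,2),(2,3),(3,0)}"
    unfolding four image_insert image_empty mods ..
  finally have eq: "{(i, Suc i mod 4) | i. i < 4} = {(0,1),(1,2),(2,3),(3,0)}" .
  show ?thesis unfolding cycle_graph_def undirected_def eq by auto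
qed

text \<open>Colourings and induced copies are studied for one adjacency relation on varying finite vertex sets,
  so that passing to an induced subgraph is just passing to a subset.\<close>

locale simple_adjacency =
  fixes adj :: "'a \<Rightarrow> 'a \<Rightarrow> bool" (infix \<open>\<sim>\<close> 50)
  assumes adj_sym: "u \<sim> v \<Longrightarrow> v \<sim> u"
    and adj_irrefl: "\<not> u \<sim> u"
begin

lemma adj_commute: "u \<sim> v \<longleftrightarrow> v \<sim> u"
  using adj_sym by blast

definition induced_copy :: "nat pair_pre_digraph \<Rightarrow> 'a set \<Rightarrow> bool" where
  "induced_copy H W \<longleftrightarrow> (\<exists>f. inj_on f (pverts H) \<and> f ` pverts H \<subseteq> W \<and>
    (\<forall>i\<in>pverts H. \<forall>j\<in>pverts H. f i \<sim> f j \<longleftrightarrow> (i, j) \<in> parcs H))"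

lemma induced_copy_mono: "induced_copy H W \<Longrightarrow> W \<subseteq> W' \<Longrightarrow> induced_copy H W'"
  unfolding induced_copy_def by blast

lemma induced_copy_listI:
  assumes "pverts H = {..<length xs}" and "distinct xs" and "set xs \<subseteq> W"
    and adj: "\<forall>j<length xs. \<forall>i<j. xs ! i \<sim> xs ! j \<longleftrightarrow> (i, j) \<in> parcs H"
    and H: "pair_graph H"
  shows "induced_copy H W"
proof -
  interpret H: pair_graph H by (rule H)
  have sym: "\<And>i j. (i, j) \<in> parcs H \<Longrightarrow> (j, i) \<in> parcs H"
    using arcs_ends_symmetric[OF H.pair_sym_arcs] by simp
  have irrefl: "\<And>i. (i, i) \<notin> parcs H"
    using H.pair_no_loops by fastforce
  have "xs ! i \<sim> xs ! j \<longleftrightarrow> (i, j) \<in> parcs H" if "i < length xs" "j < length xs" for i j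
    using that adj sym irrefl adj_commute adj_irrefl
    by (metis linorder_neqE_nat)
  moreover have "inj_on ((!) xs) {..<length xs}"
    using assms(2) by (simp add: inj_on_def nth_eq_iff_index_eq)
  ultimately show ?thesis
    unfolding induced_copy_def assms(1) using assms(3)
    by (intro exI[of _ "(!) xs"]) auto
qed

lemma induced_copy_path7I:
  assumes "length xs = 7" and "set xs \<subseteq> W"
    and adj: "\<forall>j<7. \<forall>i<j. xs ! i \<sim> xs ! j \<longleftrightarrow> j = Suc i"
  shows "induced_copy (path_graph 7) W"
proof (rule induced_copy_listI[OF _ _ _ _ pair_graph_path_graph, where xs = xs])
  \<comment> \<open>A path on seven vertices has no two vertices with the same neighbours, so that the adjacencies
    alone force the entries to be distinct.\<close>
  have "xs ! i \<noteq> xs ! j" if ij: "i < j" "j < 7" for i j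
  proof
    assume eq: "xs ! i = xs ! j"
    show False
    proof (cases "j < 6")
      case True
      then have "xs ! j \<sim> xs ! Suc j" using adj by simp
      then have "xs ! i \<sim> xs ! Suc j" using eq by simp
      then have "Suc j = Suc i" using adj True ij by simp
      then show False using ij by simp
    next
      case False
      then have j: "j = 6" using ij by simp
      have "i \<noteq> 5" using adj[rule_format, of 6 5] eq adj_irrefl j by auto
      then have i: "i < 5" using ij j by simp
      then have "xs ! i \<sim> xs ! Suc i" using adj by simp
      then have "xs ! Suc i \<sim> xs ! 6" using eq j adj_sym by simp
      then have "i = 4" using adj[rule_format, of 6 "Suc i"] i by simp
      then have "xs ! 3 \<sim> xs ! 6" using adj[rule_format, of 4 3] eq j by simp
      then show False using adj[rule_format, of 6 3] by simp
    qed
  qed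
  then show "distinct xs"
    using assms(1) by (metis distinct_conv_nth linorder_neqE_nat)
qed (use assms in \<open>auto simp: path_graph_def undirected_def\<close>)

lemma induced_copy_path7_listI:
  assumes "p0 \<sim> p1" "p1 \<sim> p2" "p2 \<sim> p3" "p3 \<sim> p4" "p4 \<sim> p5" "p5 \<sim> p6"
    and "\<not> p0 \<sim> p2" "\<not> p0 \<sim> p3" "\<not> p0 \<sim> p4" "\<not> p0 \<sim> p5" "\<not> p0 \<sim> p6"
    and "\<not> p1 \<sim> p3" "\<not> p1 \<sim> p4" "\<not> p1 \<sim> p5" "\<not> p1 \<sim> p6"
    and "\<not> p2 \<sim> p4" "\<not> p2 \<sim> p5" "\<not> p2 \<sim> p6" "\<not> p3 \<sim> p5" "\<not> p3 \<sim> p6" "\<not> p4 \<sim> p6"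
    and "set [p0, p1, p2, p3, p4, p5, p6] \<subseteq> W"
  shows "induced_copy (path_graph 7) W"
proof (rule induced_copy_path7I)
  let ?xs = "[p0, p1, p2, p3, p4, p5, p6]"
  show "length ?xs = 7" by simp
  have "\<forall>j<length ?xs. \<forall>i<j. ?xs ! i \<sim> ?xs ! j \<longleftrightarrow> j = Suc i"
    using assms(1-21) by (simp add: All_less_Suc)
  then show "\<forall>j<7. \<forall>i<j. ?xs ! i \<sim> ?xs ! j \<longleftrightarrow> j = Suc i"
    unfolding \<open>length ?xs = 7\<close> .
qed (rule assms(22))

lemma induced_copy_forkI:
  assumes "m \<sim> p" "m \<sim> q" "m \<sim> r" "r \<sim> s" "s \<sim> t"
    and "\<not> p \<sim> q" "\<not> p \<sim> r" "\<not> p \<sim> s" "\<not> p \<sim> t" "\<not> q \<sim> r" "\<not> q \<sim> s" "\<not> q \<sim> t"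
    and "\<not> m \<sim> s" "\<not> m \<sim> t" "\<not> r \<sim> t"
    and "p \<noteq> q" and "set [m, p, q, r, s, t] \<subseteq> W"
  shows "induced_copy fork_plus W"
proof (rule induced_copy_listI[of _ "[m, p, q, r, s, t]"])
  show "distinct [m, p, q, r, s, t]"
    using assms(1-16) assms(1-5)[THEN adj_sym] adj_irrefl by auto
  show "pverts fork_plus = {..<length [m, p, q, r, s, t]}"
    unfolding pverts_fork_plus by simp
  show "\<forall>j<length [m, p, q, r, s, t]. \<forall>i<j.
    [m, p, q, r, s, t] ! i \<sim> [m, p, q, r, s, t] ! j \<longleftrightarrow> (i, j) \<in> parcs fork_plus"
    using assms(1-15) by (simp add: All_less_Suc fork_plus_def undirected_def)
qed (rule assms(17) pair_graph_fork_plus)+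

text \<open>Opposite vertices of a four-cycle have the same neighbours, so the adjacencies alone cannot tell
  them apart and their distinctness is a hypothesis.\<close>

lemma C4_chord:
  assumes free: "\<not> induced_copy (cycle_graph 4) W"
    and "a \<sim> b" "b \<sim> c" "c \<sim> d" "d \<sim> a" and "a \<noteq> c" "b \<noteq> d" and W: "set [a, b, c, d] \<subseteq> W"
  shows "a \<sim> c \<or> b \<sim> d"
proof (rule ccontr)
  assume *: "\<not> (a \<sim> c \<or> b \<sim> d)"
  note arcs = parcs_cycle_graph_4
  have "induced_copy (cycle_graph 4) W"
  proof (rule induced_copy_listI[of _ "[a, b, c, d]"])
    show "distinct [a, b, c, d]"
      using assms(2-7) adj_irrefl by auto
    show "pverts (cycle_graph 4) = {..<length [a, b, c, d]}"
      by (simp add: cycle_graph_def undirected_def)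
    show "\<forall>j<length [a, b, c, d]. \<forall>i<j.
      [a, b, c, d] ! i \<sim> [a, b, c, d] ! j \<longleftrightarrow> (i, j) \<in> parcs (cycle_graph 4)"
      using assms(2-5) * adj_sym[of d a] by (simp add: All_less_Suc arcs)
  qed (use pair_graph_cycle_graph[of 4] W in simp_all)
  with free show False by blast
qed

text \<open>No distinctness has to be assumed here: if \<open>d\<close> or \<open>e\<close> coincides with one of the vertices of the
  triangle, the conclusion holds through an edge of the triangle.\<close>

lemma hammer_chord:
  assumes free: "\<not> induced_copy hammer W"
    and "a \<sim> b" "b \<sim> c" "a \<sim> c" "c \<sim> d" "d \<sim> e" and W: "set [a, b, c, d, e] \<subseteq> W"
  shows "a \<sim> d \<or> b \<sim> d \<or> a \<sim> e \<or> b \<sim> e \<or> c \<sim> e"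
proof (rule ccontr)
  assume *: "\<not> (a \<sim> d \<or> b \<sim> d \<or> a \<sim> e \<or> b \<sim> e \<or> c \<sim> e)"
  have "induced_copy hammer W"
  proof (rule induced_copy_listI[of _ "[a, b, c, d, e]"])
    show "distinct [a, b, c, d, e]"
      using assms(2-6) assms(2-6)[THEN adj_sym] * adj_irrefl by auto
    show "pverts hammer = {..<length [a, b, c, d, e]}"
      unfolding pverts_hammer by simp
    show "\<forall>j<length [a, b, c, d, e]. \<forall>i<j.
      [a, b, c, d, e] ! i \<sim> [a, b, c, d, e] ! j \<longleftrightarrow> (i, j) \<in> parcs hammer"
      using assms(2-6) * by (simp add: All_less_Suc hammer_def undirected_def)
  qed (rule W pair_graph_hammer)+
  with free show False by blast
qed

section \<open>Reductions for colourings\<close>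

definition colourable :: "'a set \<Rightarrow> nat \<Rightarrow> bool" where
  "colourable W k \<longleftrightarrow> (\<exists>c. c ` W \<subseteq> {..<k} \<and> (\<forall>u\<in>W. \<forall>v\<in>W. u \<sim> v \<longrightarrow> c u \<noteq> c v))"

definition is_clique :: "'a set \<Rightarrow> bool" where
  "is_clique K \<longleftrightarrow> (\<forall>u\<in>K. \<forall>v\<in>K. u \<noteq> v \<longrightarrow> u \<sim> v)"

definition clique_separated :: "'a set \<Rightarrow> bool" where
  "clique_separated W \<longleftrightarrow> (\<exists>A B. W = A \<union> B \<and> A \<noteq> W \<and> B \<noteq> W \<and> is_clique (A \<inter> B) \<and>
    (\<forall>a\<in>A - B. \<forall>b\<in>B - A. \<not> a \<sim> b))"

lemma colourable_mono: "colourable W k \<Longrightarrow> k \<le> k' \<Longrightarrow> colourable W k'"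
  unfolding colourable_def by (meson lessThan_subset_iff order_trans)

text \<open>Both colourings are injective on the common clique, so a permutation of the colours makes the
  second agree with the first there.\<close>

lemma colourable_glue:
  assumes A: "colourable A k" and B: "colourable B k" and clique: "is_clique (A \<inter> B)"
    and cross: "\<forall>a\<in>A - B. \<forall>b\<in>B - A. \<not> a \<sim> b"
  shows "colourable (A \<union> B) k"
proof -
  obtain f where f: "f ` A \<subseteq> {..<k}" "\<forall>u\<in>A. \<forall>v\<in>A. u \<sim> v \<longrightarrow> f u \<noteq> f v"
    using A unfolding colourable_def by blast
  obtain g where g: "g ` B \<subseteq> {..<k}" "\<forall>u\<in>B. \<forall>v\<in>B. u \<sim> v \<longrightarrow> g u \<noteq> g v"
    using B unfolding colourable_def by blast
  define S where "S = A \<inter> B"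
  have inj_f: "inj_on f S" and inj_g: "inj_on g S"
    using f(2) g(2) clique unfolding inj_on_def is_clique_def S_def by blast+
  have sub: "f ` S \<subseteq> {..<k}" "g ` S \<subseteq> {..<k}"
    using f(1) g(1) unfolding S_def by blast+
  have fin: "finite (f ` S)" "finite (g ` S)"
    using sub by (auto intro: finite_subset)
  have "card (f ` S) = card (g ` S)"
    using inj_f inj_g by (simp add: card_image)
  then have "card ({..<k} - g ` S) = card ({..<k} - f ` S)"
    using sub fin by (simp add: card_Diff_subset)
  then obtain h where h: "bij_betw h ({..<k} - g ` S) ({..<k} - f ` S)"
    using finite_same_card_bij by (metis finite_Diff finite_lessThan)
  \<comment> \<open>The recolouring of \<open>B\<close> that agrees with \<open>f\<close> on the common clique.\<close>
  define p where "p i = (if i \<in> g ` S then f (the_inv_into S g i) else h i)" for i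
  have p_g: "p (g s) = f s" if "s \<in> S" for s
    using that the_inv_into_f_f[OF inj_g] by (simp add: p_def)
  have "bij_betw p (g ` S) (f ` S)"
  proof -
    have "bij_betw (\<lambda>i. f (the_inv_into S g i)) (g ` S) (f ` S)"
      using bij_betw_trans[OF bij_betw_the_inv_into[OF inj_on_imp_bij_betw[OF inj_g]]
          inj_on_imp_bij_betw[OF inj_f]] by (simp add: comp_def)
    then show ?thesis
      by (subst bij_betw_cong[of _ _ "\<lambda>i. f (the_inv_into S g i)"]) (simp_all add: p_def)
  qed
  moreover have "bij_betw p ({..<k} - g ` S) ({..<k} - f ` S)"
    using h by (subst bij_betw_cong[of _ _ h]) (simp_all add: p_def)
  ultimately have "bij_betw p (g ` S \<union> ({..<k} - g ` S)) (f ` S \<union> ({..<k} - f ` S))"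
    by (rule bij_betw_combine) blast
  then have p: "bij_betw p {..<k} {..<k}"
    using sub by (simp add: Un_absorb1)
  define c where "c v = (if v \<in> A then f v else p (g v))" for v
  have c_A: "c v = f v" if "v \<in> A" for v using that by (simp add: c_def)
  have c_B: "c v = p (g v)" if "v \<in> B" for v
    using that p_g by (simp add: c_def S_def)
  have "c u \<noteq> c v" if "u \<in> B" "v \<in> B" "u \<sim> v" for u v
    using that g p c_B unfolding bij_betw_def inj_on_def by (metis image_subset_iff)
  moreover have "c u \<noteq> c v" if "u \<in> A" "v \<in> A" "u \<sim> v" for u v
    using that f c_A by simp
  moreover have "u \<in> A \<and> v \<in> A \<or> u \<in> B \<and> v \<in> B" if "u \<in> A \<union> B" "v \<in> A \<union> B" "u \<sim> v" for u v
    using that cross adj_sym by blast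
  moreover have "c ` A \<subseteq> {..<k}" using f(1) c_A by auto
  moreover have "c ` B \<subseteq> {..<k}"
    using g(1) p c_B unfolding bij_betw_def by (metis image_subset_iff rev_image_eqI)
  ultimately show ?thesis
    unfolding colourable_def by (intro exI[of _ c]) blast
qed

lemma colourable_low_degree:
  assumes "finite W" and "v \<in> W" and deg: "card {u \<in> W. v \<sim> u} < k" and col: "colourable (W - {v}) k"
  shows "colourable W k"
proof -
  obtain f where f: "f ` (W - {v}) \<subseteq> {..<k}"
    "\<forall>x\<in>W - {v}. \<forall>y\<in>W - {v}. x \<sim> y \<longrightarrow> f x \<noteq> f y"
    using col unfolding colourable_def by blast
  have "card (f ` {u \<in> W. v \<sim> u}) < card {..<k}"
    using deg card_image_le[of "{u \<in> W. v \<sim> u}" f] assms(1) by simp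
  then have "\<not> {..<k} \<subseteq> f ` {u \<in> W. v \<sim> u}"
    using assms(1) card_mono[of "f ` {u \<in> W. v \<sim> u}" "{..<k}"] by (simp add: linorder_not_less[symmetric]) blast
  then obtain i where i: "i < k" "i \<notin> f ` {u \<in> W. v \<sim> u}" by blast
  have "(f(v := i)) x < k" if "x \<in> W" for x
    using f(1) i(1) that by (cases "x = v") auto
  moreover have "(f(v := i)) x \<noteq> (f(v := i)) y" if xy: "x \<in> W" "y \<in> W" "x \<sim> y" for x y
  proof -
    have "i \<noteq> f u" if "u \<in> W" "v \<sim> u" for u
      using i(2) that by blast
    then show ?thesis
      using f(2) xy adj_sym[OF xy(3)] adj_irrefl by auto
  qed
  ultimately show ?thesis
    unfolding colourable_def by (intro exI[of _ "f(v := i)"]) blast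
qed

lemma colourable_universal:
  assumes "v \<in> W" and "colourable (W - {v}) k"
  shows "colourable W (Suc k)"
proof -
  obtain f where f: "f ` (W - {v}) \<subseteq> {..<k}"
    "\<forall>x\<in>W - {v}. \<forall>y\<in>W - {v}. x \<sim> y \<longrightarrow> f x \<noteq> f y"
    using assms(2) unfolding colourable_def by blast
  have "(f(v := k)) x < Suc k" if "x \<in> W" for x
    using f(1) that by (cases "x = v") (auto simp: less_Suc_eq)
  moreover have "(f(v := k)) x \<noteq> (f(v := k)) y" if "x \<in> W" "y \<in> W" "x \<sim> y" for x y
  proof -
    have "x \<noteq> v \<Longrightarrow> f x < k" "y \<noteq> v \<Longrightarrow> f y < k" using f(1) that by auto
    then show ?thesis using f(2) that adj_irrefl by auto
  qed
  ultimately show ?thesis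
    unfolding colourable_def by (intro exI[of _ "f(v := k)"]) blast
qed

lemma colourable_stable_partition3:
  assumes "W \<subseteq> X \<union> Y \<union> Z" and "\<forall>u\<in>X. \<forall>v\<in>X. \<not> u \<sim> v" and "\<forall>u\<in>Y. \<forall>v\<in>Y. \<not> u \<sim> v"
    and "\<forall>u\<in>Z. \<forall>v\<in>Z. \<not> u \<sim> v"
  shows "colourable W 3"
  unfolding colourable_def
proof (intro exI conjI ballI impI)
  let ?c = "\<lambda>v. if v \<in> X then 0 else if v \<in> Y then 1 else (2::nat)"
  show "?c ` W \<subseteq> {..<3}" by auto
  show "?c u \<noteq> ?c v" if "u \<in> W" "v \<in> W" "u \<sim> v" for u v
    using that assms by (simp split: if_split) blast
qed

section \<open>Walks and shortest paths\<close>

definition edges_in :: "'a set \<Rightarrow> ('a \<times> 'a) set" where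
  "edges_in W = {(u, v). u \<in> W \<and> v \<in> W \<and> u \<sim> v}"

lemma edges_in_iff: "(u, v) \<in> edges_in W \<longleftrightarrow> u \<in> W \<and> v \<in> W \<and> u \<sim> v"
  by (simp add: edges_in_def)

lemma sym_edges_in: "sym (edges_in W)"
  unfolding edges_in_def sym_def using adj_sym by blast

lemma edges_in_mono: "W \<subseteq> W' \<Longrightarrow> edges_in W \<subseteq> edges_in W'"
  unfolding edges_in_def by blast

lemma edges_in_relpow_sym: "(x, y) \<in> edges_in W ^^ n \<Longrightarrow> (y, x) \<in> edges_in W ^^ n"
proof (induction n arbitrary: y)
  case (Suc n)
  then obtain z where "(x, z) \<in> edges_in W ^^ n" "(z, y) \<in> edges_in W" by auto
  then show ?case
    using Suc.IH relpow_Suc_I2 symD[OF sym_edges_in] by metis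
qed simp

text \<open>The \<open>n\<close>-th power of the edge relation relates the ends of the walks of length \<open>n\<close>, and a function on
  the naturals traces such a walk.\<close>

lemma relpow_segment:
  assumes "\<forall>i<n. (f i, f (Suc i)) \<in> R" and "i \<le> j" and "j \<le> n"
  shows "(f i, f j) \<in> R ^^ (j - i)"
  using assms(2,3)
proof (induction j rule: dec_induct)
  case (step j)
  then show ?case using assms(1) by (auto simp: Suc_diff_le)
qed simp

lemma shortest_path:
  assumes "(x, y) \<in> R\<^sup>*"
  obtains n f where "f 0 = x" "f n = y" "\<forall>i<n. (f i, f (Suc i)) \<in> R" "inj_on f {..n}"
    "\<And>i j. i < j \<Longrightarrow> j \<le> n \<Longrightarrow> (f i, f j) \<in> R \<Longrightarrow> j = Suc i"
proof -
  define n where "n = (LEAST n. (x, y) \<in> R ^^ n)"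
  have n: "(x, y) \<in> R ^^ n"
    using rtrancl_imp_relpow[OF assms] unfolding n_def by (metis LeastI)
  have least: "n \<le> m" if "(x, y) \<in> R ^^ m" for m
    using that unfolding n_def by (rule Least_le)
  obtain f where f: "f 0 = x" "f n = y" "\<forall>i<n. (f i, f (Suc i)) \<in> R"
    using n relpow_fun_conv by metis
  have jump: "j - i \<le> d" if "i \<le> j" "j \<le> n" "(f i, f j) \<in> R ^^ d" for i j d
  proof -
    have "(x, f i) \<in> R ^^ i" using relpow_segment[OF f(3), of 0 i] that f(1) by simp
    moreover have "(f j, y) \<in> R ^^ (n - j)" using relpow_segment[OF f(3), of j n] that f(2) by simp
    ultimately have "(x, y) \<in> R ^^ (i + d + (n - j))"
      using that(3) relpow_trans by metis
    then show ?thesis using least that(1,2) by fastforce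
  qed
  have "j = Suc i" if "i < j" "j \<le> n" "(f i, f j) \<in> R" for i j
    using jump[of i j 1] that by auto
  moreover have "f i \<noteq> f j" if "i < j" "j \<le> n" for i j
    using jump[of i j 0] that by auto
  then have "inj_on f {..n}"
    by (intro linorder_inj_onI) auto
  ultimately show thesis using that f by blast
qed

section \<open>Triangles force a universal vertex\<close>

definition non_nbrs :: "'a set \<Rightarrow> 'a \<Rightarrow> 'a set" where
  "non_nbrs W c = {w \<in> W. w \<noteq> c \<and> \<not> c \<sim> w}"

text \<open>The neighbours of \<open>c\<close> with a neighbour in the component of \<open>v\<close> among the non-neighbours separate
  \<open>c\<close> from \<open>v\<close>. Without clique cutsets, two of them are therefore nonadjacent.\<close>

lemma nonclique_attachments:
  assumes sep: "\<not> clique_separated W" and c: "c \<in> W" and v: "v \<in> non_nbrs W c"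
  obtains x y p q where "x \<in> W" "y \<in> W" "c \<sim> x" "c \<sim> y" "x \<noteq> y" "\<not> x \<sim> y"
    "p \<in> non_nbrs W c" "q \<in> non_nbrs W c" "x \<sim> p" "q \<sim> y" "(p, q) \<in> (edges_in (non_nbrs W c))\<^sup>*"
proof -
  define R where "R = edges_in (non_nbrs W c)"
  define D where "D = {d. (v, d) \<in> R\<^sup>*}"
  define S where "S = {x \<in> W. c \<sim> x \<and> (\<exists>d\<in>D. x \<sim> d)}"
  have D_sub: "D \<subseteq> non_nbrs W c"
  proof
    fix d assume "d \<in> D"
    then have "(v, d) \<in> R\<^sup>*" unfolding D_def by blast
    then show "d \<in> non_nbrs W c"
      by (cases rule: rtranclE) (use v in \<open>auto simp: R_def edges_in_iff\<close>)
  qed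
  have D_step: "e \<in> D" if "d \<in> D" "e \<in> non_nbrs W c" "d \<sim> e" for d e
  proof -
    have "(d, e) \<in> R" using that D_sub unfolding R_def edges_in_iff by blast
    then show ?thesis using that(1) unfolding D_def by (simp add: rtrancl.rtrancl_into_rtrancl)
  qed
  have D_W: "D \<subseteq> W" and c_D: "c \<notin> D" and D_nonadj: "\<And>d. d \<in> D \<Longrightarrow> \<not> c \<sim> d"
    using D_sub unfolding non_nbrs_def by auto
  have v_D: "v \<in> D" unfolding D_def by simp
  have S_D: "S \<inter> D = {}" using D_nonadj unfolding S_def by blast
  have "\<not> is_clique S"
  proof
    assume clique: "is_clique S"
    have eq: "(W - D) \<inter> (D \<union> S) = S" using S_D unfolding S_def by blast
    have "\<not> a \<sim> b" if a: "a \<in> (W - D) - (D \<union> S)" and b: "b \<in> (D \<union> S) - (W - D)" for a b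
    proof
      assume ab: "a \<sim> b"
      have bD: "b \<in> D" using b unfolding S_def by blast
      have "a \<noteq> c" using ab D_nonadj[OF bD] by blast
      moreover have "\<not> c \<sim> a" using a ab bD unfolding S_def by blast
      ultimately have "a \<in> non_nbrs W c" using a unfolding non_nbrs_def by blast
      then have "a \<in> D" using D_step[OF bD] adj_sym[OF ab] by blast
      then show False using a by blast
    qed
    moreover have "W = (W - D) \<union> (D \<union> S)" using D_W unfolding S_def by blast
    moreover have "W - D \<noteq> W" using v_D D_W by blast
    moreover have "D \<union> S \<noteq> W" using c c_D adj_irrefl unfolding S_def by blast
    ultimately have "clique_separated W"
      unfolding clique_separated_def using clique eq
      by (intro exI[of _ "W - D"] exI[of _ "D \<union> S"]) simp
    with sep show False by blast
  qed
  then obtain x y where xy: "x \<in> S" "y \<in> S" "x \<noteq> y" "\<not> x \<sim> y"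
    unfolding is_clique_def by blast
  obtain p where p: "p \<in> D" "x \<sim> p" using xy(1) unfolding S_def by blast
  obtain q where q: "q \<in> D" "y \<sim> q" using xy(2) unfolding S_def by blast
  have "(p, v) \<in> R\<^sup>*"
    using p(1) sym_rtrancl[OF sym_edges_in] unfolding D_def R_def by (blast dest: symD)
  then have "(p, q) \<in> R\<^sup>*"
    using q(1) unfolding D_def by (blast intro: rtrancl_trans)
  then show thesis
    using that[of x y p q] xy p q D_sub adj_sym unfolding S_def R_def by blast
qed

text \<open>Otherwise \<open>c\<close>, \<open>u\<close>, \<open>v\<close> and the path from \<open>c\<close> through \<open>x\<close> to \<open>p\<close> form a hammer, where \<open>p\<close> sees
  neither \<open>u\<close> nor \<open>v\<close> as this would give a \<open>C\<^sub>4\<close> through \<open>c\<close> and \<open>x\<close>.\<close>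

lemma attachment_covers_edge:
  assumes C4: "\<not> induced_copy (cycle_graph 4) W" and hammer: "\<not> induced_copy hammer W"
    and c: "c \<in> W" and x: "x \<in> W" "c \<sim> x" and p: "p \<in> non_nbrs W c" "x \<sim> p"
    and uv: "u \<in> W" "v \<in> W" "c \<sim> u" "c \<sim> v" "u \<sim> v"
  shows "x = u \<or> x = v \<or> x \<sim> u \<or> x \<sim> v"
proof (rule ccontr)
  assume *: "\<not> ?thesis"
  have p': "p \<in> W" "p \<noteq> c" "\<not> c \<sim> p" using p unfolding non_nbrs_def by auto
  have "\<not> w \<sim> p" if w: "w \<in> W" "c \<sim> w" "x \<noteq> w" "\<not> x \<sim> w" for w
  proof
    assume "w \<sim> p"
    then have "c \<sim> p \<or> x \<sim> w"
      using C4_chord[OF C4 x(2) p(2) adj_sym[of w p] adj_sym[of c w]] w p' x c by auto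
    with w p' show False by blast
  qed
  then have "\<not> u \<sim> p" "\<not> v \<sim> p" using * uv by blast+
  moreover have "u \<sim> x \<or> v \<sim> x \<or> u \<sim> p \<or> v \<sim> p \<or> c \<sim> p"
    using hammer_chord[OF hammer uv(5) adj_sym[OF uv(4)] adj_sym[OF uv(3)] x(2) p(2)] uv x c p'
    by auto
  ultimately show False using * p' adj_sym by blast
qed

text \<open>The path \<open>y\<close>, \<open>c\<close>, \<open>x\<close>, \<open>p\<close>, \<open>q\<close>, \<open>r\<close> runs along a hole through \<open>c\<close>; on a hole of length five
  the vertices \<open>r\<close> and \<open>y\<close> coincide. This piece of the hole is all that the next lemma needs to know.\<close>

lemma hub_of_hole:
  assumes C4: "\<not> induced_copy (cycle_graph 4) W" and hammer: "\<not> induced_copy hammer W"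
    and sep: "\<not> clique_separated W"
    and W: "c \<in> W" "u \<in> W" "v \<in> W" and tri: "c \<sim> u" "c \<sim> v" "u \<sim> v" and n: "non_nbrs W c \<noteq> {}"
  obtains a y x p q r where "a \<in> W" "{y, x, p, q, r} \<subseteq> W"
    "a \<sim> c" "a \<sim> y" "a \<sim> x" "a \<sim> p" "a \<sim> q" "a \<sim> r"
    "y \<sim> c" "c \<sim> x" "x \<sim> p" "p \<sim> q" "q \<sim> r"
    "x \<noteq> y" "\<not> x \<sim> y" "\<not> c \<sim> p" "\<not> c \<sim> q" "\<not> y \<sim> p" "\<not> x \<sim> q" "\<not> x \<sim> r"
proof -
  define V where "V = non_nbrs W c"
  obtain x y p q where xy: "x \<in> W" "y \<in> W" "c \<sim> x" "c \<sim> y" "x \<noteq> y" "\<not> x \<sim> y"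
    and pq: "p \<in> V" "q \<in> V" "x \<sim> p" "q \<sim> y" "(p, q) \<in> (edges_in V)\<^sup>*"
    using nonclique_attachments[OF sep W(1)] n unfolding V_def by blast
  define R where "R = edges_in (insert x (insert y V))"
  have V: "w \<in> W \<and> w \<noteq> c \<and> \<not> c \<sim> w" if "w \<in> V" for w
    using that unfolding V_def non_nbrs_def by blast
  have "(p, q) \<in> R\<^sup>*"
    using pq(5) rtrancl_mono[OF edges_in_mono[of V "insert x (insert y V)"]] unfolding R_def by blast
  moreover have "(x, p) \<in> R" "(q, y) \<in> R"
    using pq unfolding R_def edges_in_iff by auto
  ultimately have reach: "(x, y) \<in> R\<^sup>*"
    by (blast intro: converse_rtrancl_into_rtrancl rtrancl_into_rtrancl)
  obtain k f where f: "f 0 = x" "f k = y" "\<forall>i<k. (f i, f (Suc i)) \<in> R" "inj_on f {..k}"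
    and induced: "\<And>i j. i < j \<Longrightarrow> j \<le> k \<Longrightarrow> (f i, f j) \<in> R \<Longrightarrow> j = Suc i"
    by (rule shortest_path[OF reach]) (rule that; assumption)
  have step: "f i \<sim> f j" if "j = Suc i" "i < k" for i j
  proof -
    have "(f i, f j) \<in> R" using f(3) that by simp
    then show ?thesis by (simp add: R_def edges_in_iff)
  qed
  have f_in: "f i \<in> insert x (insert y V)" if "i \<le> k" for i
  proof (cases "i = k")
    case False
    then have "i < k" using that by simp
    then have "(f i, f (Suc i)) \<in> R" using f(3) by blast
    then show ?thesis by (simp add: R_def edges_in_iff)
  qed (simp add: f(2))
  have fW: "f i \<in> W" if "i \<le> k" for i
    using f_in[OF that] xy V by blast
  have f_V: "f i \<in> V" if "0 < i" "i < k" for i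
  proof -
    have "f i \<noteq> f 0" "f i \<noteq> f k"
      using inj_onD[OF f(4), of i 0] inj_onD[OF f(4), of i k] that by auto
    then show ?thesis using f_in[of i] that f(1,2) by auto
  qed
  have far: "\<not> f i \<sim> f j" if "Suc i < j" "j \<le> k" for i j
  proof
    assume "f i \<sim> f j"
    then have "(f i, f j) \<in> R"
      using f_in[of i] f_in[of j] that unfolding R_def edges_in_iff by simp
    then show False using induced[of i j] that by simp
  qed
  have neq: "f i \<noteq> f j" if "i < j" "j \<le> k" for i j
    using inj_onD[OF f(4), of i j] that by auto
  have "k \<noteq> 0" using f(1,2) xy(5) by metis
  moreover have "k \<noteq> 1" using step[of 1 0] f(1,2) xy(6) by auto
  moreover have "k \<noteq> 2"
  proof
    assume k: "k = 2"
    have "x \<sim> f 1" "f 1 \<sim> y" using step[of 1 0] step[of 2 1] f(1,2) k by simp_all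
    moreover have "f 1 \<in> W" "f 1 \<noteq> c" using V[OF f_V[of 1]] k by simp_all
    ultimately have "c \<sim> f 1 \<or> x \<sim> y"
      using C4_chord[OF C4 xy(3) _ _ adj_sym[OF xy(4)], of "f 1"] xy W(1) by simp
    then show False using V[OF f_V[of 1]] k xy by simp
  qed
  ultimately have k: "3 \<le> k" by simp
  have f12: "\<not> c \<sim> f 1" "\<not> c \<sim> f 2" "f 1 \<noteq> c" "f 2 \<noteq> c"
    using V[OF f_V[of 1]] V[OF f_V[of 2]] k by auto
  have s: "x \<sim> f 1" "f 1 \<sim> f 2" "f 2 \<sim> f 3"
    using step[of 1 0] step[of 2 1] step[of 3 2] f(1) k by simp_all
  have d: "\<not> x \<sim> f 2" "\<not> x \<sim> f 3" "\<not> f 1 \<sim> f 3" "x \<noteq> f 2" "x \<noteq> f 3" "f 1 \<noteq> f 3"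
    using far[of 0 2] far[of 0 3] far[of 1 3] neq[of 0 2] neq[of 0 3] neq[of 1 3] f(1) k by auto
  have "\<not> f 1 \<sim> y"
    using far[of 1 k] f(2) k by simp
  then have y1: "\<not> y \<sim> f 1" using adj_sym by blast
  have q': "y \<sim> q" using adj_sym pq(4) .
  note cover = attachment_covers_edge[OF C4 hammer W(1)]
  have "\<exists>a\<in>W. c \<sim> a \<and> a \<sim> x \<and> a \<sim> y"
  proof -
    have near: "\<exists>a\<in>W. c \<sim> a \<and> a \<sim> x \<and> a \<sim> y" if w: "w \<in> W" "c \<sim> w" "x \<sim> w" for w
    proof -
      have "y = w \<or> y \<sim> w \<or> y = x \<or> y \<sim> x"
        using cover[OF xy(2,4) pq(2)[unfolded V_def] q' w(1) xy(1) w(2) xy(3) adj_sym[OF w(3)]] by blast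
      then have "y \<sim> w" using xy w adj_sym by blast
      then show ?thesis using w adj_sym by blast
    qed
    have "x = u \<or> x = v \<or> x \<sim> u \<or> x \<sim> v"
      using cover[OF xy(1,3) pq(1)[unfolded V_def] pq(3) W(2,3) tri] .
    then show ?thesis
      using near[of u] near[of v] W tri adj_sym by blast
  qed
  then obtain a where a: "a \<in> W" "c \<sim> a" "a \<sim> x" "a \<sim> y" by blast
  \<comment> \<open>Adjacency to \<open>a\<close> propagates along an induced path: a first failure at \<open>z\<close> makes the
    next vertex close either a hammer or a four-cycle.\<close>
  have propagate: "a \<sim> z" if "w \<in> W" "w' \<in> W" "z \<in> W" "z' \<in> W" "a \<sim> w" "a \<sim> w'" "w \<sim> w'"
    "w' \<sim> z" "z \<sim> z'" "\<not> w \<sim> z" "\<not> w \<sim> z'" "\<not> w' \<sim> z'" "w' \<noteq> z'" "a \<noteq> z" for w w' z z'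
  proof (rule ccontr)
    assume az: "\<not> a \<sim> z"
    have "\<not> a \<sim> z'"
    proof
      assume "a \<sim> z'"
      then have "a \<sim> z \<or> w' \<sim> z'"
        using C4_chord[OF C4 that(6,8,9) adj_sym[of a z']] that a(1) by auto
      then show False using az that by blast
    qed
    moreover have "w \<sim> z \<or> a \<sim> z \<or> w \<sim> z' \<or> a \<sim> z' \<or> w' \<sim> z'"
      using hammer_chord[OF hammer adj_sym[OF that(5)] that(6,7,8,9)] that a(1) by auto
    ultimately show False using az that by blast
  qed
  have fa: "f i \<noteq> a" if "0 < i" "i < k" for i
    using V[OF f_V[OF that]] a by blast
  have f123W: "f 1 \<in> W" "f 2 \<in> W" "f 3 \<in> W" using fW k by auto
  have a1: "a \<sim> f 1"
    using propagate[of c x "f 1" "f 2"] a(1,3) xy(1,3) W(1) s d f12 f123W fa[of 1] k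
      adj_sym[OF a(2)] by simp
  have a2: "a \<sim> f 2"
    using propagate[of x "f 1" "f 2" "f 3"] a(1,3) a1 xy(1) s d f123W fa[of 2] k by simp
  have a3: "a \<sim> f 3"
  proof (cases "k = 3")
    case True then show ?thesis using f(2) a by simp
  next
    case False
    then have k4: "4 \<le> k" using k by simp
    have "f 3 \<sim> f 4" using step[of 4 3] k4 by simp
    then show ?thesis
      using propagate[of "f 1" "f 2" "f 3" "f 4"] a(1) a1 a2 s d f123W fa[of 3] k4 fW[of 4]
        far[of 1 4] far[of 2 4] neq[of 2 4] by simp
  qed
  show thesis
    by (rule that[of a y x "f 1" "f 2" "f 3"])
      (use a adj_sym[OF a(2)] a1 a2 a3 s d f12 y1 xy adj_sym[OF xy(4)] f123W in simp_all)
qed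

text \<open>An attachment \<open>z\<close> of the non-neighbours of the hub \<open>a\<close> covers every edge of the hole, since the hole
  lies in the neighbourhood of \<open>a\<close>. So \<open>z\<close> is off the hole, and missing \<open>c\<close> or \<open>p\<close> it would see both
  hole neighbours of the missed vertex, a \<open>C\<^sub>4\<close>. Two nonadjacent attachments would then close a
  \<open>C\<^sub>4\<close> with the nonadjacent vertices \<open>c\<close> and \<open>p\<close>.\<close>

lemma triangle_imp_universal:
  assumes C4: "\<not> induced_copy (cycle_graph 4) W" and hammer: "\<not> induced_copy hammer W"
    and sep: "\<not> clique_separated W"
    and W: "c \<in> W" "u \<in> W" "v \<in> W" and tri: "c \<sim> u" "c \<sim> v" "u \<sim> v"
  shows "\<exists>a\<in>W. \<forall>w\<in>W - {a}. a \<sim> w"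
proof (cases "non_nbrs W c = {}")
  case True
  then show ?thesis using W(1) unfolding non_nbrs_def by blast
next
  case False
  obtain a y x p q r where a: "a \<in> W" and in_W: "{y, x, p, q, r} \<subseteq> W"
    and hub: "a \<sim> c" "a \<sim> y" "a \<sim> x" "a \<sim> p" "a \<sim> q" "a \<sim> r"
    and path: "y \<sim> c" "c \<sim> x" "x \<sim> p" "p \<sim> q" "q \<sim> r"
    and non: "x \<noteq> y" "\<not> x \<sim> y" "\<not> c \<sim> p" "\<not> c \<sim> q" "\<not> y \<sim> p" "\<not> x \<sim> q" "\<not> x \<sim> r"
    by (rule hub_of_hole[OF C4 hammer sep W tri False]) (rule that; assumption)
  have "non_nbrs W a = {}"
  proof (rule ccontr)
    assume "non_nbrs W a \<noteq> {}"
    then obtain w where w: "w \<in> non_nbrs W a" by blast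
    obtain t t' s s' where t: "t \<in> W" "t' \<in> W" "a \<sim> t" "a \<sim> t'" "t \<noteq> t'" "\<not> t \<sim> t'"
      "s \<in> non_nbrs W a" "s' \<in> non_nbrs W a" "t \<sim> s" "s' \<sim> t'"
      by (rule nonclique_attachments[OF sep a w]) (rule that; assumption)
    have complete: "z \<sim> c \<and> z \<sim> p" if z: "z \<in> W" "a \<sim> z" "e \<in> non_nbrs W a" "z \<sim> e" for z e
    proof -
      have cov: "z = g \<or> z = h \<or> z \<sim> g \<or> z \<sim> h"
        if "g \<in> W" "h \<in> W" "a \<sim> g" "a \<sim> h" "g \<sim> h" for g h
        using attachment_covers_edge[OF C4 hammer a z that] .
      have mem: "y \<in> W" "x \<in> W" "p \<in> W" "q \<in> W" "r \<in> W"
        using in_W by simp_all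
      note cov_yc = cov[OF mem(1) W(1) hub(2,1) path(1)]
        and cov_cx = cov[OF W(1) mem(2) hub(1,3) path(2)]
        and cov_xp = cov[OF mem(2,3) hub(3,4) path(3)]
        and cov_pq = cov[OF mem(3,4) hub(4,5) path(4)]
        and cov_qr = cov[OF mem(4,5) hub(5,6) path(5)]
      have diff: "c \<noteq> p" "c \<noteq> q" "y \<noteq> p" "x \<noteq> q" "x \<noteq> r"
        using path non adj_sym by metis+
      have z_not: "z \<noteq> c" "z \<noteq> x" "z \<noteq> y" "z \<noteq> p" "z \<noteq> q"
        subgoal using cov_pq diff non by metis
        subgoal using cov_qr diff non by metis
        subgoal using cov_xp diff non adj_sym by metis
        subgoal using cov_yc diff non adj_sym by metis
        subgoal using cov_cx diff non adj_sym by metis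
        done
      have "z \<sim> c"
      proof (rule ccontr)
        assume zc: "\<not> z \<sim> c"
        then have "z \<sim> x" "z \<sim> y" using cov_yc cov_cx z_not by blast+
        then have "z \<sim> c \<or> x \<sim> y"
          using C4_chord[OF C4 _ adj_sym[OF path(2)] adj_sym[OF path(1)] adj_sym[of z y]]
            z(1) mem W(1) z_not non(1) by simp
        then show False using zc non by blast
      qed
      moreover have "z \<sim> p"
      proof (rule ccontr)
        assume zp: "\<not> z \<sim> p"
        then have "z \<sim> x" "z \<sim> q" using cov_xp cov_pq z_not by blast+
        then have "z \<sim> p \<or> x \<sim> q"
          using C4_chord[OF C4 _ path(3,4) adj_sym[of z q]] z(1) mem z_not diff by simp
        then show False using zp non by blast
      qed
      ultimately show ?thesis by blast
    qed
    have tt: "t \<sim> c" "t \<sim> p" "t' \<sim> c" "t' \<sim> p"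
      using complete[OF t(1,3,7,9)] complete[OF t(2,4,8) adj_sym[OF t(10)]] by blast+
    have "c \<noteq> p" using path(4) non(4) by metis
    then have "t \<sim> t' \<or> c \<sim> p"
      using C4_chord[OF C4 tt(1) adj_sym[OF tt(3)] tt(4) adj_sym[OF tt(2)]] t(1,2,5) W(1) in_W
      by simp
    then show False using t non by blast
  qed
  then show ?thesis using a unfolding non_nbrs_def by blast
qed

section \<open>Triangle-free graphs with a pentagon\<close>

definition triangle_free :: "'a set \<Rightarrow> bool" where
  "triangle_free W \<longleftrightarrow> (\<forall>a\<in>W. \<forall>b\<in>W. \<forall>c\<in>W. a \<sim> b \<longrightarrow> b \<sim> c \<longrightarrow> \<not> a \<sim> c)"

lemma triangle_freeD:
  "triangle_free W \<Longrightarrow> a \<sim> b \<Longrightarrow> b \<sim> c \<Longrightarrow> a \<in> W \<Longrightarrow> b \<in> W \<Longrightarrow> c \<in> W \<Longrightarrow> \<not> a \<sim> c"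
  unfolding triangle_free_def by blast

lemma common_nbr_unique:
  assumes tf: "triangle_free W" and C4: "\<not> induced_copy (cycle_graph 4) W"
    and "a \<sim> x" "a \<sim> y" "b \<sim> x" "b \<sim> y" "x \<noteq> y" and W: "a \<in> W" "b \<in> W" "x \<in> W" "y \<in> W"
  shows "a = b"
proof (rule ccontr)
  assume "a \<noteq> b"
  then have "a \<sim> b \<or> x \<sim> y"
    using C4_chord[OF C4 assms(3) adj_sym[OF assms(5)] assms(6) adj_sym[OF assms(4)]] assms(7) W
    by simp
  moreover have "\<not> a \<sim> b"
    using triangle_freeD[OF tf assms(3) adj_sym[OF assms(5)]] W by blast
  moreover have "\<not> x \<sim> y"
    using triangle_freeD[OF tf adj_sym[OF assms(3)] assms(4)] W by blast
  ultimately show False by blast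
qed

definition pentagon :: "'a set \<Rightarrow> 'a \<Rightarrow> 'a \<Rightarrow> 'a \<Rightarrow> 'a \<Rightarrow> 'a \<Rightarrow> bool" where
  "pentagon W h0 h1 h2 h3 h4 \<longleftrightarrow> set [h0, h1, h2, h3, h4] \<subseteq> W \<and>
    h0 \<sim> h1 \<and> h1 \<sim> h2 \<and> h2 \<sim> h3 \<and> h3 \<sim> h4 \<and> h4 \<sim> h0"

lemma pentagon_rotate: "pentagon W h0 h1 h2 h3 h4 \<Longrightarrow> pentagon W h1 h2 h3 h4 h0"
  unfolding pentagon_def by simp

lemma pentagon_mem:
  assumes "pentagon W h0 h1 h2 h3 h4"
  shows "h0 \<in> W" "h1 \<in> W" "h2 \<in> W" "h3 \<in> W" "h4 \<in> W"
  using assms unfolding pentagon_def by simp_all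

lemma pentagon_edges:
  assumes "pentagon W h0 h1 h2 h3 h4"
  shows "h0 \<sim> h1" "h1 \<sim> h2" "h2 \<sim> h3" "h3 \<sim> h4" "h4 \<sim> h0"
    "h1 \<sim> h0" "h2 \<sim> h1" "h3 \<sim> h2" "h4 \<sim> h3" "h0 \<sim> h4"
  using assms adj_sym unfolding pentagon_def by blast+

lemma pentagon_chordless:
  assumes "triangle_free W" and p: "pentagon W h0 h1 h2 h3 h4"
  shows "\<not> h0 \<sim> h2" "\<not> h1 \<sim> h3" "\<not> h2 \<sim> h4" "\<not> h3 \<sim> h0" "\<not> h4 \<sim> h1"
    "\<not> h2 \<sim> h0" "\<not> h3 \<sim> h1" "\<not> h4 \<sim> h2" "\<not> h0 \<sim> h3" "\<not> h1 \<sim> h4"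
proof -
  note e = pentagon_edges[OF p] and m = pentagon_mem[OF p] and t = triangle_freeD[OF assms(1)]
  show "\<not> h0 \<sim> h2" "\<not> h1 \<sim> h3" "\<not> h2 \<sim> h4" "\<not> h3 \<sim> h0" "\<not> h4 \<sim> h1"
    by (rule t[OF e(1,2)], (rule m)+, rule t[OF e(2,3)], (rule m)+, rule t[OF e(3,4)], (rule m)+,
        rule t[OF e(4,5)], (rule m)+, rule t[OF e(5,1)], (rule m)+)
  then show "\<not> h2 \<sim> h0" "\<not> h3 \<sim> h1" "\<not> h4 \<sim> h2" "\<not> h0 \<sim> h3" "\<not> h1 \<sim> h4"
    by (metis adj_sym)+
qed

lemma pentagon_nbr:
  assumes tf: "triangle_free W" and C4: "\<not> induced_copy (cycle_graph 4) W"
    and p: "pentagon W h0 h1 h2 h3 h4" and a: "a \<in> W" "a \<sim> h0" and new: "a \<noteq> h1" "a \<noteq> h4"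
  shows "\<not> a \<sim> h1" "\<not> a \<sim> h2" "\<not> a \<sim> h3" "\<not> a \<sim> h4"
    "\<not> h1 \<sim> a" "\<not> h2 \<sim> a" "\<not> h3 \<sim> a" "\<not> h4 \<sim> a"
proof -
  note e = pentagon_edges[OF p] and m = pentagon_mem[OF p] and n = pentagon_chordless[OF tf p]
  show "\<not> a \<sim> h1" by (rule triangle_freeD[OF tf a(2) e(1) a(1) m(1,2)])
  show "\<not> a \<sim> h4" by (rule triangle_freeD[OF tf a(2) e(10) a(1) m(1,5)])
  show "\<not> a \<sim> h2"
  proof
    assume "a \<sim> h2"
    moreover have "h0 \<noteq> h2" using n(4) e(8) by metis
    ultimately show False
      using common_nbr_unique[OF tf C4 a(2) _ e(6,2) _ a(1) m(2,1,3)] new(1) by blast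
  qed
  show "\<not> a \<sim> h3"
  proof
    assume "a \<sim> h3"
    moreover have "h0 \<noteq> h3" using n(1) e(8) by metis
    ultimately show False
      using common_nbr_unique[OF tf C4 a(2) _ e(5,9) _ a(1) m(5,1,4)] new(2) by blast
  qed
  show "\<not> h1 \<sim> a" "\<not> h2 \<sim> a" "\<not> h3 \<sim> a" "\<not> h4 \<sim> a"
    using \<open>\<not> a \<sim> h1\<close> \<open>\<not> a \<sim> h2\<close> \<open>\<not> a \<sim> h3\<close> \<open>\<not> a \<sim> h4\<close> adj_sym by blast+
qed

text \<open>The condition is symmetrized only to serve as a rewrite rule in either direction.\<close>

definition far_from :: "'a set \<Rightarrow> 'a \<Rightarrow> bool" where
  "far_from C z \<longleftrightarrow> (\<forall>h\<in>C. \<not> z \<sim> h \<and> \<not> h \<sim> z)"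

lemma far_from_pentagonD:
  assumes "far_from {h0, h1, h2, h3, h4} z"
  shows "\<not> z \<sim> h0" "\<not> z \<sim> h1" "\<not> z \<sim> h2" "\<not> z \<sim> h3" "\<not> z \<sim> h4"
    "\<not> h0 \<sim> z" "\<not> h1 \<sim> z" "\<not> h2 \<sim> z" "\<not> h3 \<sim> z" "\<not> h4 \<sim> z"
  using assms unfolding far_from_def by simp_all

text \<open>The path is \<open>z'\<close>, \<open>z\<close>, \<open>a\<close>, \<open>h0\<close>, \<open>h1\<close>, \<open>h2\<close>, \<open>h3\<close>; the fork\<open>\<^sup>+\<close> is centred at \<open>h0\<close> with leaves
  \<open>h1\<close> and \<open>h4\<close> and long leg \<open>a\<close>, \<open>z\<close>, \<open>z'\<close>.\<close>

lemma pentagon_with_tail: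
  assumes tf: "triangle_free W" and C4: "\<not> induced_copy (cycle_graph 4) W"
    and p: "pentagon W h0 h1 h2 h3 h4"
    and W: "a \<in> W" "z \<in> W" "z' \<in> W" and adj: "a \<sim> h0" "z \<sim> a" "z \<sim> z'"
    and far: "far_from {h0, h1, h2, h3, h4} z" "far_from {h0, h1, h2, h3, h4} z'"
  shows "induced_copy (path_graph 7) W" "induced_copy fork_plus W"
proof -
  note e = pentagon_edges[OF p] and m = pentagon_mem[OF p] and n = pentagon_chordless[OF tf p]
    and fz = far_from_pentagonD[OF far(1)] and fz' = far_from_pentagonD[OF far(2)]
  have "a \<noteq> h1" "a \<noteq> h4" using fz adj(2) by metis+
  note na = pentagon_nbr[OF tf C4 p W(1) adj(1) this]
  have az: "\<not> z' \<sim> a" "\<not> a \<sim> z'"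
    using triangle_freeD[OF tf adj_sym[OF adj(3)] adj(2) W(3,2,1)] adj_sym by blast+
  show "induced_copy (path_graph 7) W"
    by (rule induced_copy_path7_listI[of z' z a h0 h1 h2 h3])
      (use adj adj_sym[OF adj(2)] adj_sym[OF adj(3)] e m n fz fz' na az W in simp_all)
  have "h1 \<noteq> h4" using n(2) e(9) by metis
  then show "induced_copy fork_plus W"
    by (intro induced_copy_forkI[of h0 h1 h4 a z z'])
      (use adj adj_sym[OF adj(1)] adj_sym[OF adj(2)] adj_sym[OF adj(3)] e m n fz fz' na az W
        in simp_all)
qed

text \<open>The path goes from \<open>a0\<close> through \<open>z\<close> and \<open>a1\<close> to \<open>h1\<close> and on around the pentagon to \<open>h4\<close>. The
  fork\<open>\<^sup>+\<close> is centred at \<open>z\<close> with leaves \<open>a0\<close> and \<open>a1\<close>; its long leg goes through \<open>b\<close> to the pentagon and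
  one step further, away from \<open>h0\<close> and \<open>h1\<close>.\<close>

lemma pentagon_with_tripod:
  assumes tf: "triangle_free W" and C4: "\<not> induced_copy (cycle_graph 4) W"
    and p: "pentagon W h0 h1 h2 h3 h4"
    and W: "z \<in> W" "a0 \<in> W" "a1 \<in> W" "b \<in> W" and adj: "z \<sim> a0" "z \<sim> a1" "z \<sim> b"
    and on: "a0 \<sim> h0" "a1 \<sim> h1" "b \<sim> h2 \<or> b \<sim> h3 \<or> b \<sim> h4"
    and far: "far_from {h0, h1, h2, h3, h4} z"
  shows "induced_copy (path_graph 7) W" "induced_copy fork_plus W"
proof -
  note e = pentagon_edges[OF p] and m = pentagon_mem[OF p] and n = pentagon_chordless[OF tf p]
    and fz = far_from_pentagonD[OF far]
  have off: "c \<noteq> h0" "c \<noteq> h1" "c \<noteq> h2" "c \<noteq> h3" "c \<noteq> h4" if "z \<sim> c" for c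
    using fz that by metis+
  note p1 = pentagon_rotate[OF p]
  note p2 = pentagon_rotate[OF p1]
  note p3 = pentagon_rotate[OF p2]
  note p4 = pentagon_rotate[OF p3]
  note n0 = pentagon_nbr[OF tf C4 p W(2) on(1) off(2,5)[OF adj(1)]]
    and n1 = pentagon_nbr[OF tf C4 p1 W(3) on(2) off(3,1)[OF adj(2)]]
  have stable: "\<not> c \<sim> d" if "z \<sim> c" "z \<sim> d" "c \<in> W" "d \<in> W" for c d
    using triangle_freeD[OF tf adj_sym[OF that(1)] that(2)] that W by blast
  show "induced_copy (path_graph 7) W"
    by (rule induced_copy_path7_listI[of a0 z a1 h1 h2 h3 h4])
      (use adj adj_sym[OF adj(1)] on e m n fz n0 n1 stable W in simp_all)
  have "a0 \<noteq> a1" using n0(1) on(2) by metis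
  note tripod = induced_copy_forkI[OF adj(1,2,3) _ _ stable[OF adj(1,2) W(2,3)]
      stable[OF adj(1,3) W(2,4)] _ _ stable[OF adj(2,3) W(3,4)] _ _ _ _ _ this]
  from on(3) show "induced_copy fork_plus W"
  proof (elim disjE)
    assume b: "b \<sim> h2"
    note nb = pentagon_nbr[OF tf C4 p2 W(4) b off(4,2)[OF adj(3)]]
    show ?thesis by (rule tripod[OF b e(3)]) (use n0 n1 fz nb m W in simp_all)
  next
    assume b: "b \<sim> h3"
    note nb = pentagon_nbr[OF tf C4 p3 W(4) b off(5,3)[OF adj(3)]]
    show ?thesis by (rule tripod[OF b e(8)]) (use n0 n1 fz nb m W in simp_all)
  next
    assume b: "b \<sim> h4"
    note nb = pentagon_nbr[OF tf C4 p4 W(4) b off(1,4)[OF adj(3)]]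
    show ?thesis by (rule tripod[OF b e(9)]) (use n0 n1 fz nb m W in simp_all)
  qed
qed

lemma far_from_commute: "far_from C z \<longleftrightarrow> (\<forall>h\<in>C. \<not> z \<sim> h)"
  unfolding far_from_def using adj_sym by blast

lemma pentagon_tripod_cyclic:
  assumes tf: "triangle_free W" and C4: "\<not> induced_copy (cycle_graph 4) W"
    and F: "\<not> induced_copy (path_graph 7) W \<or> \<not> induced_copy fork_plus W"
    and p: "pentagon W h0 h1 h2 h3 h4" and z: "z \<in> W" "far_from {h0, h1, h2, h3, h4} z"
    and Q_def: "\<And>h. Q h \<longleftrightarrow> (\<exists>b\<in>W. z \<sim> b \<and> b \<sim> h)"
  shows "\<not> (Q h0 \<and> Q h1 \<and> (Q h2 \<or> Q h3 \<or> Q h4))"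
proof
  assume *: "Q h0 \<and> Q h1 \<and> (Q h2 \<or> Q h3 \<or> Q h4)"
  obtain a0 where a0: "a0 \<in> W" "z \<sim> a0" "a0 \<sim> h0" using * unfolding Q_def by blast
  obtain a1 where a1: "a1 \<in> W" "z \<sim> a1" "a1 \<sim> h1" using * unfolding Q_def by blast
  obtain b where b: "b \<in> W" "z \<sim> b" "b \<sim> h2 \<or> b \<sim> h3 \<or> b \<sim> h4"
    using * unfolding Q_def by blast
  show False
    using F pentagon_with_tripod[OF tf C4 p z(1) a0(1) a1(1) b(1) a0(2) a1(2) b(2) a0(3) a1(3) b(3) z(2)]
    by blast
qed

text \<open>By connectedness some vertex \<open>z\<close> far from the pentagon has a neighbour next to it, and by the lemma
  on tails then all its neighbours are next to it. A vertex of the pentagon has at most one common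
  neighbour with \<open>z\<close>, so that the at least three neighbours of \<open>z\<close> reach three different vertices of
  the pentagon. Among three vertices of a pentagon two are consecutive, and the tripod applies.\<close>

lemma pentagon_dominating:
  assumes "finite W" and tf: "triangle_free W" and C4: "\<not> induced_copy (cycle_graph 4) W"
    and F: "\<not> induced_copy (path_graph 7) W \<or> \<not> induced_copy fork_plus W"
    and p: "pentagon W h0 h1 h2 h3 h4"
    and conn: "\<And>u v. u \<in> W \<Longrightarrow> v \<in> W \<Longrightarrow> (u, v) \<in> (edges_in W)\<^sup>*"
    and deg: "\<And>v. v \<in> W \<Longrightarrow> 3 \<le> card {u \<in> W. v \<sim> u}"
    and v: "v \<in> W"
  shows "\<not> far_from {h0, h1, h2, h3, h4} v"
proof
  assume far_v: "far_from {h0, h1, h2, h3, h4} v"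
  define C where "C = {h0, h1, h2, h3, h4}"
  define Z where "Z = {z \<in> W. far_from C z}"
  note p1 = pentagon_rotate[OF p]
  note p2 = pentagon_rotate[OF p1]
  note p3 = pentagon_rotate[OF p2]
  note p4 = pentagon_rotate[OF p3]
  note m = pentagon_mem[OF p]
  have C1: "C = {h1, h2, h3, h4, h0}" and C2: "C = {h2, h3, h4, h0, h1}"
    and C3: "C = {h3, h4, h0, h1, h2}" and C4': "C = {h4, h0, h1, h2, h3}"
    unfolding C_def by auto
  have exits: "z' \<notin> Z" if z: "z \<in> Z" and a: "a \<in> W - Z" "z \<sim> a" and z': "z \<sim> z'" for z a z'
  proof
    assume "z' \<in> Z"
    then have zz: "z \<in> W" "z' \<in> W" "far_from C z" "far_from C z'" using z unfolding Z_def by auto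
    obtain h where h: "h \<in> C" "a \<sim> h"
      using a(1) unfolding Z_def far_from_commute by blast
    have aW: "a \<in> W" using a(1) by blast
    have both: "induced_copy (path_graph 7) W \<and> induced_copy fork_plus W"
      if "pentagon W h a1 a2 a3 a4" "C = {h, a1, a2, a3, a4}" for a1 a2 a3 a4
    proof -
      have "far_from {h, a1, a2, a3, a4} z" "far_from {h, a1, a2, a3, a4} z'"
        using zz(3,4) unfolding that(2) .
      from pentagon_with_tail[OF tf C4 that(1) aW zz(1,2) h(2) a(2) z' this]
      show ?thesis ..
    qed
    have "h = h0 \<or> h = h1 \<or> h = h2 \<or> h = h3 \<or> h = h4"
      using h(1) unfolding C_def by simp
    then have "induced_copy (path_graph 7) W \<and> induced_copy fork_plus W"
    proof (elim disjE)
      assume "h = h0" then show ?thesis using both p C_def by metis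
    next
      assume "h = h1" then show ?thesis using both p1 C1 by metis
    next
      assume "h = h2" then show ?thesis using both p2 C2 by metis
    next
      assume "h = h3" then show ?thesis using both p3 C3 by metis
    next
      assume "h = h4" then show ?thesis using both p4 C4' by metis
    qed
    then show False using F by blast
  qed
  have "\<exists>z\<in>Z. \<exists>a\<in>W - Z. z \<sim> a"
  proof (rule ccontr)
    assume closed: "\<not> ?thesis"
    have "y \<in> Z" if "(v, y) \<in> (edges_in W)\<^sup>*" for y
      using that
    proof (induction rule: rtrancl_induct)
      case base
      then show ?case using far_v v unfolding Z_def C_def by blast
    next
      case (step y w)
      from step.hyps(2) have "w \<in> W" "y \<sim> w" by (simp_all add: edges_in_iff)
      then show ?case using closed step.IH by blast
    qed
    then have "h0 \<in> Z" using conn[OF v m(1)] by blast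
    then show False using pentagon_edges(1)[OF p] unfolding Z_def C_def far_from_def by blast
  qed
  then obtain z a where za: "z \<in> Z" "a \<in> W - Z" "z \<sim> a" by blast
  have z: "z \<in> W" "far_from C z" using za(1) unfolding Z_def by blast+
  define Q where "Q h \<longleftrightarrow> (\<exists>b\<in>W. z \<sim> b \<and> b \<sim> h)" for h
  define N where "N h = {b \<in> W. z \<sim> b \<and> b \<sim> h}" for h
  have "{u \<in> W. z \<sim> u} \<subseteq> N h0 \<union> N h1 \<union> N h2 \<union> N h3 \<union> N h4"
  proof
    fix u assume "u \<in> {u \<in> W. z \<sim> u}"
    then have u: "u \<in> W" "z \<sim> u" by blast+
    then have "\<not> far_from C u" using exits[OF za(1,2,3)] unfolding Z_def by blast
    then show "u \<in> N h0 \<union> N h1 \<union> N h2 \<union> N h3 \<union> N h4"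
      using u unfolding far_from_commute C_def N_def by blast
  qed
  then have "card {u \<in> W. z \<sim> u} \<le> card (N h0 \<union> N h1 \<union> N h2 \<union> N h3 \<union> N h4)"
    using assms(1) by (intro card_mono) (auto simp: N_def)
  also have "\<dots> \<le> card (N h0) + card (N h1) + card (N h2) + card (N h3) + card (N h4)"
    using card_Un_le[of "N h0 \<union> N h1 \<union> N h2 \<union> N h3" "N h4"]
      card_Un_le[of "N h0 \<union> N h1 \<union> N h2" "N h3"] card_Un_le[of "N h0 \<union> N h1" "N h2"]
      card_Un_le[of "N h0" "N h1"] by linarith
  finally have sum: "3 \<le> card (N h0) + card (N h1) + card (N h2) + card (N h3) + card (N h4)"
    using deg[OF z(1)] by linarith
  have small: "card (N h) \<le> 1 \<and> (Q h \<or> card (N h) = 0)" if h: "h \<in> C" "h \<in> W" for h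
  proof -
    have hz: "h \<noteq> z"
    proof
      assume "h = z"
      then have "far_from C h" using z(2) by simp
      then show False
        using h(1) pentagon_edges[OF p] unfolding C_def far_from_def by blast
    qed
    have "b = b'" if "b \<in> N h" "b' \<in> N h" for b b'
      using that common_nbr_unique[OF tf C4 _ _ _ _ hz _ _ h(2) z(1), of b b'] adj_sym
      unfolding N_def by blast
    then have "card (N h) \<le> Suc 0"
      using assms(1) by (subst card_le_Suc0_iff_eq) (auto simp: N_def)
    moreover have "Q h \<or> N h = {}" unfolding Q_def N_def by blast
    ultimately show ?thesis by auto
  qed
  have s: "card (N h0) \<le> 1 \<and> (Q h0 \<or> card (N h0) = 0)" "card (N h1) \<le> 1 \<and> (Q h1 \<or> card (N h1) = 0)"
    "card (N h2) \<le> 1 \<and> (Q h2 \<or> card (N h2) = 0)" "card (N h3) \<le> 1 \<and> (Q h3 \<or> card (N h3) = 0)"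
    "card (N h4) \<le> 1 \<and> (Q h4 \<or> card (N h4) = 0)"
    using small[of h0] small[of h1] small[of h2] small[of h3] small[of h4] m
    unfolding C_def by simp_all
  note tripod = pentagon_tripod_cyclic[OF tf C4 F _ z(1) _ Q_def]
  have q0: "\<not> (Q h0 \<and> Q h1 \<and> (Q h2 \<or> Q h3 \<or> Q h4))" by (rule tripod[OF p z(2)[unfolded C_def]])
  have q1: "\<not> (Q h1 \<and> Q h2 \<and> (Q h3 \<or> Q h4 \<or> Q h0))" by (rule tripod[OF p1 z(2)[unfolded C1]])
  have q2: "\<not> (Q h2 \<and> Q h3 \<and> (Q h4 \<or> Q h0 \<or> Q h1))" by (rule tripod[OF p2 z(2)[unfolded C2]])
  have q3: "\<not> (Q h3 \<and> Q h4 \<and> (Q h0 \<or> Q h1 \<or> Q h2))" by (rule tripod[OF p3 z(2)[unfolded C3]])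
  have q4: "\<not> (Q h4 \<and> Q h0 \<and> (Q h1 \<or> Q h2 \<or> Q h3))" by (rule tripod[OF p4 z(2)[unfolded C4']])
  show False
    by (cases "Q h0"; cases "Q h1"; cases "Q h2"; cases "Q h3"; cases "Q h4")
      (use q0 q1 q2 q3 q4 s sum in simp_all)
qed

lemma stable_Un:
  assumes "\<forall>u\<in>A. \<forall>v\<in>A. \<not> u \<sim> v" and "\<forall>u\<in>B. \<forall>v\<in>B. \<not> u \<sim> v" and "\<forall>u\<in>A. \<forall>v\<in>B. \<not> u \<sim> v"
  shows "\<forall>u\<in>A \<union> B. \<forall>v\<in>A \<union> B. \<not> u \<sim> v"
  using assms adj_sym by blast

lemma stable_nbhd:
  assumes tf: "triangle_free W" and "h \<in> W" and "A \<subseteq> {v \<in> W. v \<sim> h}"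
  shows "\<forall>u\<in>A. \<forall>v\<in>A. \<not> u \<sim> v"
proof (intro ballI)
  fix u v assume "u \<in> A" "v \<in> A"
  then have uv: "u \<in> W" "v \<in> W" "u \<sim> h" "v \<sim> h" using assms(3) by blast+
  show "\<not> u \<sim> v" by (rule triangle_freeD[OF tf uv(3) adj_sym[OF uv(4)] uv(1) assms(2) uv(2)])
qed

lemma stable_pair_nbhds:
  assumes tf: "triangle_free W" and C4: "\<not> induced_copy (cycle_graph 4) W"
    and h: "h \<in> W" "h' \<in> W" "h \<sim> h'" and u: "u \<in> W" "u \<sim> h" "u \<noteq> h'" and v: "v \<in> W" "v \<sim> h'" "v \<noteq> h"
  shows "\<not> u \<sim> v"
proof
  assume uv: "u \<sim> v"
  have "u \<sim> h' \<or> h \<sim> v"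
    using C4_chord[OF C4 u(2) h(3) adj_sym[OF v(2)] adj_sym[OF uv]] u v h by simp
  moreover have "\<not> u \<sim> h'" by (rule triangle_freeD[OF tf u(2) h(3) u(1) h(1,2)])
  moreover have "\<not> h \<sim> v" by (rule triangle_freeD[OF tf h(3) adj_sym[OF v(2)] h(1,2) v(1)])
  ultimately show False by blast
qed

text \<open>The vertices off the pentagon split into the stable sets \<open>A h\<close> of private neighbours of its vertices
  \<open>h\<close>, and there are no edges between the sets of two consecutive vertices. The colour classes are
  unions that use only these facts.\<close>

lemma dominating_pentagon_colourable:
  assumes tf: "triangle_free W" and C4: "\<not> induced_copy (cycle_graph 4) W"
    and p: "pentagon W h0 h1 h2 h3 h4"
    and dom: "\<And>v. v \<in> W \<Longrightarrow> \<not> far_from {h0, h1, h2, h3, h4} v"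
  shows "colourable W 3"
proof -
  define A where "A h = {v \<in> W. v \<sim> h} - {h0, h1, h2, h3, h4}" for h
  note p1 = pentagon_rotate[OF p]
  note p2 = pentagon_rotate[OF p1]
  note p3 = pentagon_rotate[OF p2]
  note p4 = pentagon_rotate[OF p3]
  note m = pentagon_mem[OF p] and e = pentagon_edges[OF p] and n = pentagon_chordless[OF tf p]
  have A: "v \<in> W" "v \<sim> h" "v \<noteq> h0" "v \<noteq> h1" "v \<noteq> h2" "v \<noteq> h3" "v \<noteq> h4" if "v \<in> A h" for v h
    using that unfolding A_def by auto
  have stable_A: "\<forall>u\<in>A h. \<forall>v\<in>A h. \<not> u \<sim> v" if "h \<in> W" for h
    by (rule stable_nbhd[OF tf that]) (auto simp: A_def)
  have A01: "\<forall>u\<in>A h0. \<forall>v\<in>A h1. \<not> u \<sim> v"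
    using stable_pair_nbhds[OF tf C4 m(1,2) e(1)] A by blast
  have A34: "\<forall>u\<in>A h3. \<forall>v\<in>A h4. \<not> u \<sim> v"
    using stable_pair_nbhds[OF tf C4 m(4,5) e(4)] A by blast
  have n0: "\<not> h4 \<sim> v" if "v \<in> A h0" for v
    using pentagon_nbr[OF tf C4 p A(1,2)[OF that] A(4,7)[OF that]] by blast
  have n1: "\<not> h4 \<sim> v" if "v \<in> A h1" for v
    using pentagon_nbr[OF tf C4 p1 A(1,2)[OF that] A(5,3)[OF that]] by blast
  have n2: "\<not> h1 \<sim> v" "\<not> h3 \<sim> v" if "v \<in> A h2" for v
    using pentagon_nbr[OF tf C4 p2 A(1,2)[OF that] A(6,4)[OF that]] by blast+
  have n3: "\<not> h0 \<sim> v" "\<not> h2 \<sim> v" if "v \<in> A h3" for v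
    using pentagon_nbr[OF tf C4 p3 A(1,2)[OF that] A(7,5)[OF that]] by blast+
  have n4: "\<not> h0 \<sim> v" "\<not> h2 \<sim> v" if "v \<in> A h4" for v
    using pentagon_nbr[OF tf C4 p4 A(1,2)[OF that] A(3,6)[OF that]] by blast+
  have "W \<subseteq> ({h0, h2} \<union> (A h3 \<union> A h4)) \<union> ({h1, h3} \<union> A h2) \<union> ({h4} \<union> (A h0 \<union> A h1))"
  proof
    fix v assume v: "v \<in> W"
    have "v \<in> A h" if "v \<sim> h" "v \<notin> {h0, h1, h2, h3, h4}" for h
      using that v unfolding A_def by blast
    then show "v \<in> ({h0, h2} \<union> (A h3 \<union> A h4)) \<union> ({h1, h3} \<union> A h2) \<union> ({h4} \<union> (A h0 \<union> A h1))"
      using dom[OF v] unfolding far_from_commute by blast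
  qed
  moreover have "\<forall>u\<in>{h0, h2} \<union> (A h3 \<union> A h4). \<forall>v\<in>{h0, h2} \<union> (A h3 \<union> A h4). \<not> u \<sim> v"
    by (intro stable_Un stable_A m A34) (use n n3 n4 adj_irrefl in auto)
  moreover have "\<forall>u\<in>{h1, h3} \<union> A h2. \<forall>v\<in>{h1, h3} \<union> A h2. \<not> u \<sim> v"
    by (intro stable_Un stable_A m) (use n n2 adj_irrefl in auto)
  moreover have "\<forall>u\<in>{h4} \<union> (A h0 \<union> A h1). \<forall>v\<in>{h4} \<union> (A h0 \<union> A h1). \<not> u \<sim> v"
    by (intro stable_Un stable_A m A01) (use n0 n1 adj_irrefl in auto)
  ultimately show ?thesis
    by (rule colourable_stable_partition3)
qed

section \<open>Shortest odd closed walks\<close>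

text \<open>Colour by the parity of the walks from a fixed root.\<close>

lemma no_odd_closed_walk_colourable:
  assumes conn: "\<And>u v. u \<in> W \<Longrightarrow> v \<in> W \<Longrightarrow> (u, v) \<in> (edges_in W)\<^sup>*"
    and even: "\<And>x n. (x, x) \<in> edges_in W ^^ n \<Longrightarrow> even n"
  shows "colourable W 2"
proof (cases "W = {}")
  case True
  then show ?thesis unfolding colourable_def by simp
next
  case False
  then obtain r where r: "r \<in> W" by blast
  define c where "c v = (if \<exists>n. even n \<and> (r, v) \<in> edges_in W ^^ n then 0 else 1::nat)" for v
  have "c u \<noteq> c v" if uv: "u \<in> W" "v \<in> W" "u \<sim> v" for u v
  proof -
    have parity: "odd (m + n)" if walks: "(r, u) \<in> edges_in W ^^ m" "(r, v) \<in> edges_in W ^^ n" for m n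
    proof -
      have "(u, v) \<in> edges_in W" using uv by (simp add: edges_in_iff)
      then have "(r, v) \<in> edges_in W ^^ Suc m" by (rule relpow_Suc_I[OF walks(1)])
      then have "(r, r) \<in> edges_in W ^^ (Suc m + n)"
        using edges_in_relpow_sym[OF walks(2)] by (rule relpow_trans)
      then show ?thesis using even[of r "Suc m + n"] by simp
    qed
    obtain m where m: "(r, u) \<in> edges_in W ^^ m"
      using rtrancl_imp_relpow[OF conn[OF r uv(1)]] by blast
    obtain n where n: "(r, v) \<in> edges_in W ^^ n"
      using rtrancl_imp_relpow[OF conn[OF r uv(2)]] by blast
    show ?thesis
    proof (cases "even m")
      case True
      then have "\<exists>n. even n \<and> (r, u) \<in> edges_in W ^^ n" using m by blast
      moreover have "\<not> (\<exists>n. even n \<and> (r, v) \<in> edges_in W ^^ n)"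
        using parity[OF m] True by (metis odd_add)
      ultimately show ?thesis unfolding c_def by simp
    next
      case False
      then have "even n" using parity[OF m n] by simp
      then have "\<exists>n. even n \<and> (r, v) \<in> edges_in W ^^ n" using n by blast
      moreover have "\<not> (\<exists>m. even m \<and> (r, u) \<in> edges_in W ^^ m)"
        using parity[OF _ n] \<open>even n\<close> by (metis odd_add)
      ultimately show ?thesis unfolding c_def by simp
    qed
  qed
  moreover have "c v < 2" for v unfolding c_def by simp
  then have "c ` W \<subseteq> {..<2}" by blast
  ultimately show ?thesis unfolding colourable_def by (intro exI[of _ c]) blast
qed

text \<open>The walk is a shortest one. A walk of length \<open>d\<close> between two of its vertices closes up with either
  of the two arcs between them, and exactly one of these closed walks is odd, the total length being
  odd. The conclusion says that the odd one has length at least \<open>n\<close>.\<close>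

lemma shortest_odd_closed_walk:
  assumes "(x, x) \<in> edges_in W ^^ n" and "odd n"
  obtains n f where "odd n" "f n = f 0" "\<And>i. i < n \<Longrightarrow> (f i, f (Suc i)) \<in> edges_in W"
    "\<And>i j d. i \<le> j \<Longrightarrow> j \<le> n \<Longrightarrow> (f i, f j) \<in> edges_in W ^^ d \<Longrightarrow>
      (if odd (d + (j - i)) then n \<le> d + (j - i) else j - i \<le> d)"
proof -
  define R where "R = edges_in W"
  define P where "P k \<longleftrightarrow> odd k \<and> (\<exists>y. (y, y) \<in> R ^^ k)" for k
  define k where "k = (LEAST k. P k)"
  have "P n" using assms unfolding P_def R_def by blast
  then have "P k" unfolding k_def by (rule LeastI)
  then obtain y where k: "odd k" "(y, y) \<in> R ^^ k" unfolding P_def by blast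
  have least: "k \<le> l" if "odd l" "(w, w) \<in> R ^^ l" for l w
    using that unfolding k_def P_def by (intro Least_le) blast
  obtain f where f: "f 0 = y" "f k = y" "\<forall>i<k. (f i, f (Suc i)) \<in> R"
    using k(2) relpow_fun_conv by metis
  show thesis
  proof (rule that[of k f])
    show "odd k" by (rule k(1))
    show "f k = f 0" using f by simp
    show "(f i, f (Suc i)) \<in> edges_in W" if "i < k" for i
      using f(3) that unfolding R_def by blast
    fix i j d assume ij: "i \<le> j" "j \<le> k" and d: "(f i, f j) \<in> edges_in W ^^ d"
    have reverse: "(f j, f i) \<in> R ^^ d" using edges_in_relpow_sym[OF d] unfolding R_def .
    have seg: "(f i, f j) \<in> R ^^ (j - i)" using relpow_segment[OF f(3) ij] .
    have "(f j, f k) \<in> R ^^ (k - j)" "(f 0, f i) \<in> R ^^ i"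
      using relpow_segment[OF f(3) ij(2) order_refl] relpow_segment[OF f(3) le0, of i] ij
      by simp_all
    then have rest: "(f j, f i) \<in> R ^^ (k - j + i)"
      unfolding f(1,2) by (rule relpow_trans)
    have "(f i, f i) \<in> R ^^ (d + (k - j + i))"
      using relpow_trans[OF d[folded R_def] rest] .
    then have long: "odd (d + (k - j + i)) \<longrightarrow> k \<le> d + (k - j + i)" using least by blast
    have "(f i, f i) \<in> R ^^ (j - i + d)" using relpow_trans[OF seg reverse] .
    then have short: "odd (j - i + d) \<longrightarrow> k \<le> j - i + d" using least by blast
    have parity: "odd (d + (k - j + i)) \<longleftrightarrow> even (d + (j - i))"
    proof -
      have "d + (k - j + i) + (d + (j - i)) = k + 2 * d" using ij by simp
      then have "odd (d + (k - j + i) + (d + (j - i)))" using k(1) by simp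
      then show ?thesis by (simp add: odd_add)
    qed
    show "if odd (d + (j - i)) then k \<le> d + (j - i) else j - i \<le> d"
    proof (cases "odd (d + (j - i))")
      case True
      then have "k \<le> j - i + d" using short by (metis add.commute)
      then show ?thesis using True by simp
    next
      case False
      then have "k \<le> d + (k - j + i)" using long parity by blast
      then have "j - i \<le> d" using ij by linarith
      then show ?thesis using False by simp
    qed
  qed
qed

text \<open>By minimality the walk is an induced cycle. With a third neighbour \<open>z\<close> of \<open>f 0\<close>, the path is \<open>z\<close>
  followed by \<open>f 0\<close> up to \<open>f 5\<close>, and the fork\<open>\<^sup>+\<close> is centred at \<open>f 0\<close> with leaves \<open>z\<close> and \<open>f (n - 1)\<close>.\<close>

lemma long_odd_hole:
  assumes tf: "triangle_free W" and C4: "\<not> induced_copy (cycle_graph 4) W"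
    and deg: "\<And>v. v \<in> W \<Longrightarrow> 3 \<le> card {u \<in> W. v \<sim> u}"
    and n: "odd n" "7 \<le> n" and closed: "f n = f 0"
    and step: "\<And>i. i < n \<Longrightarrow> (f i, f (Suc i)) \<in> edges_in W"
    and shortest: "\<And>i j d. i \<le> j \<Longrightarrow> j \<le> n \<Longrightarrow> (f i, f j) \<in> edges_in W ^^ d \<Longrightarrow>
      (if odd (d + (j - i)) then n \<le> d + (j - i) else j - i \<le> d)"
  shows "induced_copy (path_graph 7) W" "induced_copy fork_plus W"
proof -
  have fW: "f i \<in> W" if "i < n" for i
    using step[OF that] by (simp add: edges_in_iff)
  have adj: "f i \<sim> f j" if "j = Suc i" "i < n" for i j
    using step[OF that(2)] that(1) by (simp add: edges_in_iff)
  have nonadj: "\<not> f i \<sim> f j" if "Suc i < j" "j < n" "j - i < n - 1" for i j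
  proof
    assume "f i \<sim> f j"
    then have "(f i, f j) \<in> edges_in W ^^ 1"
      using fW[of i] fW[of j] that by (simp add: edges_in_iff)
    from shortest[OF _ _ this] show False using that by (simp split: if_splits)
  qed
  have inj: "f i \<noteq> f j" if "i < j" "j < n" for i j
  proof
    assume "f i = f j"
    then have "(f i, f j) \<in> edges_in W ^^ 0" by simp
    from shortest[OF _ _ this] show False using that by (simp split: if_splits)
  qed
  define l where "l = f (n - 1)"
  have l: "l \<sim> f 0" "l \<in> W"
    using adj[of n "n - 1"] closed n fW[of "n - 1"] unfolding l_def by simp_all
  have "\<not> {u \<in> W. f 0 \<sim> u} \<subseteq> {f 1, l}"
  proof
    assume "{u \<in> W. f 0 \<sim> u} \<subseteq> {f 1, l}"
    then have "card {u \<in> W. f 0 \<sim> u} \<le> card {f 1, l}" by (intro card_mono) auto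
    also have "\<dots> \<le> 2" by (simp add: card_insert_if)
    finally show False using deg[OF fW[of 0]] n by simp
  qed
  then obtain z where z: "z \<in> W" "f 0 \<sim> z" "z \<noteq> f 1" "z \<noteq> l" by blast
  \<comment> \<open>A second neighbour of \<open>z\<close> on the walk would be at walk distance two from \<open>f 0\<close>,
    and then \<open>z\<close> would close a four-cycle.\<close>
  have zf: "\<not> z \<sim> f j" if j: "0 < j" "j < n" for j
  proof
    assume zj: "z \<sim> f j"
    have "(f 0, z) \<in> edges_in W" "(z, f j) \<in> edges_in W"
      using z fW[of 0] fW[of j] j zj by (simp_all add: edges_in_iff)
    then have "(f 0, f j) \<in> edges_in W ^^ 2"
      by (auto simp: numeral_2_eq_2)
    from shortest[OF _ _ this]
    have dist: "odd j \<Longrightarrow> n \<le> 2 + j" "even j \<Longrightarrow> j \<le> 2" using j by simp_all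
    show False
    proof (cases "odd j")
      case True
      then have "n \<le> 2 + j" by (rule dist(1))
      moreover have "j \<noteq> n - 1" using True n by auto
      ultimately have j': "j = n - 2" using j by simp
      have "n - 1 = Suc j" using j' n by linarith
      then have "f j \<sim> l" using adj[of "n - 1" j] j unfolding l_def by simp
      then show False
        using common_nbr_unique[OF tf C4 adj_sym[OF z(2)] zj l(1) adj_sym[OF \<open>f j \<sim> l\<close>]] inj[of 0 j]
          j z(1,4) l(2) fW[of 0] fW[of j] by simp
    next
      case False
      then have "j \<le> 2" "j \<noteq> 1" using dist(2) by auto
      then have j': "j = 2" using j by simp
      have "f 0 \<sim> f 1" "f 1 \<sim> f j" using adj[of 1 0] adj[of 2 1] j' n by simp_all
      then show False
        using common_nbr_unique[OF tf C4 adj_sym[OF z(2)] zj adj_sym[OF \<open>f 0 \<sim> f 1\<close>]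
            \<open>f 1 \<sim> f j\<close>] inj[of 0 j] j z(1,3) n fW[of 0] fW[of 1] fW[of j] by simp
    qed
  qed
  have e: "f 0 \<sim> f 1" "f 1 \<sim> f 2" "f 2 \<sim> f 3" "f 3 \<sim> f 4" "f 4 \<sim> f 5"
    using adj[of 1 0] adj[of 2 1] adj[of 3 2] adj[of 4 3] adj[of 5 4] n by simp_all
  have W: "f 0 \<in> W" "f 1 \<in> W" "f 2 \<in> W" "f 3 \<in> W" "f 4 \<in> W" "f 5 \<in> W"
    using fW n by simp_all
  show "induced_copy (path_graph 7) W"
    by (rule induced_copy_path7_listI[of z "f 0" "f 1" "f 2" "f 3" "f 4" "f 5"])
      (use z(1) adj_sym[OF z(2)] e W n zf nonadj in simp_all)
  have l_far: "\<not> l \<sim> f 1" "\<not> l \<sim> f 2" "\<not> l \<sim> f 3"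
    using nonadj[of 1 "n - 1"] nonadj[of 2 "n - 1"] nonadj[of 3 "n - 1"] n
    unfolding l_def adj_commute[of "f (n - 1)"] by simp_all
  have "\<not> z \<sim> l" using zf[of "n - 1"] n unfolding l_def by simp
  then show "induced_copy fork_plus W"
    by (intro induced_copy_forkI[of "f 0" z l "f 1" "f 2" "f 3"])
      (use z l_far l adj_sym[OF l(1)] e W n zf nonadj in simp_all)
qed

lemma triangle_free_colourable:
  assumes fin: "finite W" and tf: "triangle_free W" and C4: "\<not> induced_copy (cycle_graph 4) W"
    and F: "\<not> induced_copy (path_graph 7) W \<or> \<not> induced_copy fork_plus W"
    and conn: "\<And>u v. u \<in> W \<Longrightarrow> v \<in> W \<Longrightarrow> (u, v) \<in> (edges_in W)\<^sup>*"
    and deg: "\<And>v. v \<in> W \<Longrightarrow> 3 \<le> card {u \<in> W. v \<sim> u}"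
  shows "colourable W 3"
proof (cases "\<exists>x n. (x, x) \<in> edges_in W ^^ n \<and> odd n")
  case False
  then have "colourable W 2"
    by (intro no_odd_closed_walk_colourable conn) blast+
  then show ?thesis by (rule colourable_mono) simp
next
  case True
  then obtain x m where "(x, x) \<in> edges_in W ^^ m" "odd m" by blast
  then obtain n f where n: "odd n" and closed: "f n = f 0"
    and step: "\<And>i. i < n \<Longrightarrow> (f i, f (Suc i)) \<in> edges_in W"
    and shortest: "\<And>i j d. i \<le> j \<Longrightarrow> j \<le> n \<Longrightarrow> (f i, f j) \<in> edges_in W ^^ d \<Longrightarrow>
      (if odd (d + (j - i)) then n \<le> d + (j - i) else j - i \<le> d)"
    by (rule shortest_odd_closed_walk) (rule that; assumption)
  have fW: "f i \<in> W" if "i < n" for i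
    using step[OF that] by (simp add: edges_in_iff)
  have adj: "f i \<sim> f j" if "j = Suc i" "i < n" for i j
    using step[OF that(2)] that(1) by (simp add: edges_in_iff)
  have "n \<noteq> 1" using adj[of 1 0] closed adj_irrefl by auto
  moreover have "n \<noteq> 3"
  proof
    assume k: "n = 3"
    then have "f 0 \<sim> f 1" "f 1 \<sim> f 2" "f 2 \<sim> f 0" "f 0 \<in> W" "f 1 \<in> W" "f 2 \<in> W"
      using adj[of 1 0] adj[of 2 1] adj[of 3 2] closed fW by simp_all
    then show False using triangle_freeD[OF tf] adj_sym by blast
  qed
  moreover have "\<not> 7 \<le> n"
    using long_odd_hole[OF tf C4 deg n _ closed step shortest] F by blast
  ultimately have k: "n = 5" using n by presburger
  have "pentagon W (f 0) (f 1) (f 2) (f 3) (f 4)"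
    using adj[of 1 0] adj[of 2 1] adj[of 3 2] adj[of 4 3] adj[of 5 4] closed fW k
    unfolding pentagon_def by simp
  then show ?thesis
    using dominating_pentagon_colourable[OF tf C4] pentagon_dominating[OF fin tf C4 F _ conn deg]
    by blast
qed

section \<open>The colouring bound\<close>

lemma connected_if_not_clique_separated:
  assumes sep: "\<not> clique_separated W" and uv: "u \<in> W" "v \<in> W"
  shows "(u, v) \<in> (edges_in W)\<^sup>*"
proof (rule ccontr)
  assume no: "(u, v) \<notin> (edges_in W)\<^sup>*"
  define A where "A = {w \<in> W. (u, w) \<in> (edges_in W)\<^sup>*}"
  have "\<not> a \<sim> b" if "a \<in> A" "b \<in> W - A" for a b
  proof
    assume "a \<sim> b"
    then have "(a, b) \<in> edges_in W" using that by (simp add: A_def edges_in_iff)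
    then have "b \<in> A" using that unfolding A_def by (blast intro: rtrancl_into_rtrancl)
    then show False using that by blast
  qed
  then have "clique_separated W"
    unfolding clique_separated_def
    using uv no by (intro exI[of _ A] exI[of _ "W - A"]) (auto simp: A_def is_clique_def)
  with sep show False by blast
qed

text \<open>Letting \<open>k\<close> be any bound on the clique sizes makes the deletion of a universal vertex an
  instance of the induction hypothesis with \<open>k - 1\<close>. In the triangle-free case an edge gives
  \<open>k \<ge> 2\<close>, so that three colours are available and all degrees are at least three.\<close>

theorem colourable_Suc_clique_size:
  assumes "finite W" and "\<not> induced_copy (cycle_graph 4) W" and "\<not> induced_copy hammer W"
    and "\<not> induced_copy (path_graph 7) W \<or> \<not> induced_copy fork_plus W"
    and "\<And>K. K \<subseteq> W \<Longrightarrow> is_clique K \<Longrightarrow> card K \<le> k"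
  shows "colourable W (Suc k)"
  using assms
proof (induction W arbitrary: k rule: finite_psubset_induct)
  case (psubset W)
  note C4 = psubset.prems(1) and hammer = psubset.prems(2) and F = psubset.prems(3)
    and cliques = psubset.prems(4)
  have IH: "colourable V (Suc k')"
    if "V \<subset> W" "\<And>K. K \<subseteq> V \<Longrightarrow> is_clique K \<Longrightarrow> card K \<le> k'" for V k'
  proof (rule psubset.IH[OF that(1) _ _ _ that(2)])
    have sub: "V \<subseteq> W" using that(1) by blast
    show "\<not> induced_copy (cycle_graph 4) V" using C4 induced_copy_mono[OF _ sub] by blast
    show "\<not> induced_copy hammer V" using hammer induced_copy_mono[OF _ sub] by blast
    show "\<not> induced_copy (path_graph 7) V \<or> \<not> induced_copy fork_plus V"
      using F induced_copy_mono[OF _ sub] by blast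
  qed
  have IH_same: "colourable V (Suc k)" if "V \<subset> W" for V
    using that by (intro IH cliques) auto
  show ?case
  proof (cases "clique_separated W")
    case True
    then obtain A B where AB: "W = A \<union> B" "A \<noteq> W" "B \<noteq> W" "is_clique (A \<inter> B)"
      "\<forall>a\<in>A - B. \<forall>b\<in>B - A. \<not> a \<sim> b"
      unfolding clique_separated_def by blast
    have "A \<subset> W" "B \<subset> W" using AB(1-3) by blast+
    then show ?thesis
      using colourable_glue[OF IH_same IH_same AB(4,5)] AB(1) by simp
  next
    case sep: False
    show ?thesis
    proof (cases "\<exists>a\<in>W. \<forall>w\<in>W - {a}. a \<sim> w")
      case True
      then obtain a where a: "a \<in> W" "\<forall>w\<in>W - {a}. a \<sim> w" by blast
      have clique_insert: "Suc (card K) \<le> k" if K: "K \<subseteq> W - {a}" "is_clique K" for K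
      proof -
        have "finite K" "a \<notin> K" using K(1) psubset.hyps finite_subset by blast+
        moreover have "is_clique (insert a K)"
          using K a(2) adj_sym unfolding is_clique_def by blast
        ultimately show ?thesis
          using cliques[of "insert a K"] K(1) a(1) by auto
      qed
      have "1 \<le> k" using clique_insert[of "{}"] by (simp add: is_clique_def)
      have "colourable (W - {a}) (Suc (k - 1))"
      proof (rule IH)
        show "card K \<le> k - 1" if "K \<subseteq> W - {a}" "is_clique K" for K
          using clique_insert[OF that] by simp
      qed (use a(1) in blast)
      then show ?thesis
        using colourable_universal[OF a(1)] \<open>1 \<le> k\<close> by simp
    next
      case no_universal: False
      have tf: "triangle_free W"
        unfolding triangle_free_def
        using triangle_imp_universal[OF C4 hammer sep] no_universal by blast
      show ?thesis
      proof (cases "\<exists>v\<in>W. card {u \<in> W. v \<sim> u} < Suc k")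
        case True
        then obtain v where v: "v \<in> W" "card {u \<in> W. v \<sim> u} < Suc k" by blast
        have "W - {v} \<subset> W" using v(1) by blast
        then show ?thesis
          using colourable_low_degree[OF psubset.hyps v IH_same] by blast
      next
        case high: False
        show ?thesis
        proof (cases "W = {}")
          case True
          then show ?thesis unfolding colourable_def by simp
        next
          case False
          then obtain v where v: "v \<in> W" by blast
          have "{u \<in> W. v \<sim> u} \<noteq> {}"
            using high v by (metis card.empty zero_less_Suc)
          then obtain u where u: "u \<in> W" "v \<sim> u" by blast
          have "v \<noteq> u" using u(2) adj_irrefl by metis
          moreover have "is_clique {v, u}" using u(2) adj_sym unfolding is_clique_def by auto
          ultimately have k2: "2 \<le> k" using cliques[of "{v, u}"] u v by simp
          have "colourable W 3"
          proof (rule triangle_free_colourable[OF psubset.hyps tf C4 F])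
            show "3 \<le> card {u \<in> W. w \<sim> u}" if "w \<in> W" for w
            proof -
              have "\<not> card {u \<in> W. w \<sim> u} < Suc k" using high that by blast
              then show ?thesis using k2 by simp
            qed
          qed (rule connected_if_not_clique_separated[OF sep])
          then show ?thesis by (rule colourable_mono) (use k2 in simp)
        qed
      qed
    qed
  qed
qed

end

lemma (in graph) simple_adjacency: "simple_adjacency (dominates G)"
proof
  show "v \<rightarrow>\<^bsub>G\<^esub> u" if "u \<rightarrow>\<^bsub>G\<^esub> v" for u v
    using sym_arcs that by (rule arcs_ends_symmetric)
qed (use adj_not_same in blast)

text \<open>Arcs of \<open>G\<close> have their own type, so an embedding of the vertices has to be extended to arcs by
  choosing the arc with the prescribed ends; it is unique since there are no parallel arcs.\<close>

lemma (in graph) not_induced_copy: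
  assumes free: "induced_free G \<H>" and H: "H \<in> \<H>" "pair_graph H"
  shows "\<not> simple_adjacency.induced_copy (dominates G) H (verts G)"
proof
  interpret A: simple_adjacency "dominates G" by (rule simple_adjacency)
  interpret H: pair_graph H by (rule H(2))
  assume "A.induced_copy H (verts G)"
  then obtain f where inj: "inj_on f (pverts H)" and fG: "f ` pverts H \<subseteq> verts G"
    and adj: "\<forall>i\<in>pverts H. \<forall>j\<in>pverts H. f i \<rightarrow>\<^bsub>G\<^esub> f j \<longleftrightarrow> (i, j) \<in> parcs H"
    unfolding A.induced_copy_def by blast
  define arc_of where "arc_of = (\<lambda>(i, j). SOME e. e \<in> arcs G \<and> tail G e = f i \<and> head G e = f j)"
  have arc_of: "arc_of (i, j) \<in> arcs G \<and> tail G (arc_of (i, j)) = f i \<and> head G (arc_of (i, j)) = f j"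
    if ij: "(i, j) \<in> parcs H" for i j
  proof -
    have "f i \<rightarrow>\<^bsub>G\<^esub> f j" using adj ij H.in_arcsD1 H.in_arcsD2 by blast
    then have "\<exists>e. e \<in> arcs G \<and> tail G e = f i \<and> head G e = f j"
      by (elim reachableE) blast
    then show ?thesis
      unfolding arc_of_def prod.case by (rule someI_ex)
  qed
  define K where "K = G \<restriction> (f ` pverts H)"
  define h where "h = \<lparr>iso_verts = f, iso_arcs = arc_of, iso_head = head G, iso_tail = tail G\<rparr>"
  have ends: "i \<in> pverts H \<and> j \<in> pverts H" if "(i, j) \<in> parcs H" for i j
    using that H.in_arcsD1 H.in_arcsD2 by blast
  have "induced_subgraph K G"
    unfolding K_def using fG by (rule induced_induce)
  moreover have "pre_digraph.digraph_isomorphism (with_proj H) h"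
    unfolding pre_digraph.digraph_isomorphism_def
  proof (intro conjI)
    show "wf_digraph (with_proj H)" by (rule H.wf_digraph)
    show "inj_on (iso_verts h) (verts (with_proj H))" using inj by (simp add: h_def)
    show "inj_on (iso_arcs h) (arcs (with_proj H))"
    proof (rule inj_onI)
      fix e e' assume e: "e \<in> arcs (with_proj H)" "e' \<in> arcs (with_proj H)"
        and eq: "iso_arcs h e = iso_arcs h e'"
      obtain i j i' j' where ij: "e = (i, j)" "e' = (i', j')" by (cases e, cases e') blast
      have ij_in: "(i, j) \<in> parcs H" "(i', j') \<in> parcs H"
        using e by (simp_all add: ij)
      have "arc_of (i, j) = arc_of (i', j')"
        using eq by (simp add: h_def ij)
      then have "f i = f i'" "f j = f j'"
        using arc_of[OF ij_in(1)] arc_of[OF ij_in(2)] by metis+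
      then show "e = e'"
        using inj_onD[OF inj] ends[OF ij_in(1)] ends[OF ij_in(2)] unfolding ij by blast
    qed
    show "\<forall>a\<in>arcs (with_proj H).
       iso_verts h (tail (with_proj H) a) = iso_tail h (iso_arcs h a) \<and>
       iso_verts h (head (with_proj H) a) = iso_head h (iso_arcs h a)"
      by (auto simp: h_def arc_of)
  qed
  moreover have "K = app_iso h (with_proj H)"
  proof (rule pre_digraph.equality)
    show "arcs K = arcs (app_iso h (with_proj H))"
    proof (intro equalityI subsetI)
      fix e assume "e \<in> arcs K"
      then have "e \<in> arcs G" "tail G e \<in> f ` pverts H" "head G e \<in> f ` pverts H"
        by (simp_all add: K_def)
      then obtain i j where e: "e \<in> arcs G" "i \<in> pverts H" "j \<in> pverts H"
          "tail G e = f i" "head G e = f j"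
        by blast
      have "f i \<rightarrow>\<^bsub>G\<^esub> f j"
        using e by (intro dominatesI[of e]) (simp_all add: arc_to_ends_def)
      then have ij: "(i, j) \<in> parcs H"
        using adj e(2,3) by blast
      have "arc_of (i, j) = e"
        using arc_of[OF ij] e by (intro no_multi_arcs) (simp_all add: arc_to_ends_def)
      then show "e \<in> arcs (app_iso h (with_proj H))"
        using imageI[OF ij, of arc_of] by (simp add: h_def)
    next
      fix e assume "e \<in> arcs (app_iso h (with_proj H))"
      then have "e \<in> arc_of ` parcs H" by (simp add: h_def)
      then obtain i j where ij: "(i, j) \<in> parcs H" "e = arc_of (i, j)" by auto
      then show "e \<in> arcs K"
        using arc_of[OF ij(1)] ends[OF ij(1)] by (simp add: K_def)
    qed
  qed (simp_all add: K_def h_def induce_subgraph_def)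
  ultimately have "induced_subgraph K G \<and> digraph_iso (with_proj H) K"
    unfolding digraph_iso_def by blast
  then show False
    using free H(1) unfolding induced_free_def by blast
qed

theorem corollary1p1:
  fixes G :: "('a, 'b) pre_digraph" and F :: "nat pair_pre_digraph"
  assumes "F = path_graph 7 \<or> F = fork_plus"
    and "graph G"
    and "induced_free G {cycle_graph 4, F, hammer}"
  shows "chromatic_number G \<le> clique_number G + 1"
proof -
  interpret graph G by (rule assms(2))
  interpret A: simple_adjacency "dominates G" by (rule simple_adjacency)
  note free = not_induced_copy[OF assms(3)]
  have C4: "\<not> A.induced_copy (cycle_graph 4) (verts G)"
    by (rule free) (simp_all add: pair_graph_cycle_graph)
  have hammer: "\<not> A.induced_copy hammer (verts G)"
    by (rule free) (simp_all add: pair_graph_hammer)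
  have "\<not> A.induced_copy F (verts G)"
    by (rule free) (use assms(1) pair_graph_path_graph pair_graph_fork_plus in auto)
  then have F: "\<not> A.induced_copy (path_graph 7) (verts G) \<or> \<not> A.induced_copy fork_plus (verts G)"
    using assms(1) by blast
  have "A.colourable (verts G) (Suc (clique_number G))"
  proof (rule A.colourable_Suc_clique_size[OF finite_verts C4 hammer F])
    fix K assume "K \<subseteq> verts G" "A.is_clique K"
    then have "clique G K" unfolding clique_def A.is_clique_def by blast
    then show "card K \<le> clique_number G"
      unfolding clique_number_def using finite_cliques by (intro Max_ge) auto
  qed
  then obtain c where c: "c ` verts G \<subseteq> {..<Suc (clique_number G)}"
    "\<forall>u\<in>verts G. \<forall>v\<in>verts G. u \<rightarrow>\<^bsub>G\<^esub> v \<longrightarrow> c u \<noteq> c v"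
    unfolding A.colourable_def by blast
  have "proper_colouring G (clique_number G + 1) c"
    unfolding proper_colouring_def using c adj_in_verts by auto
  then show ?thesis
    unfolding chromatic_number_def by (intro Least_le) blast
qed

end
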